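(* Let $M,N,\chi,L_x,L_y>0$ be real, $m,n$ positive integers and $\varepsilon>0$, with the associated grid, operators and functions $S,H,\kappa$ described in the context. Then for every time step $s>0$ the following scheme is uniquely solvable: for every periodic $\phi^k\in\mathcal{C}_{\overline m\times\overline n}$ with values in $(0,1/\rho)$ and every realization $r_1,r_2$ (real arrays indexed by $1\le i\le m$, $1\le j\le n$, extended periodically to $C_{\overline m}\times C_{\overline n}$) of the random variables defining $$\xi_{i,j}=-\frac{\sqrt2}{\sqrt{h_xh_ys}}\Big(a_x(D_xr_1)_{i,j}+a_y(D_yr_2)_{i,j}\Big),\quad 1\le i\le m,\ 1\le j\le n,$$ there exists exactly one periodic $\phi^{k+1}\in\mathcal{C}_{\overline m\times\overline n}$ with values in $(0,1/\rho)$ such that, on $C_m\times C_n$, $$\phi^{k+1}-\phi^k=s\,\Delta_h\mu^{k+1}+s\,\varepsilon\,\xi,$$ where $$\mu^{k+1}=S'(\phi^{k+1})+\kappa'(\phi^{k+1})\big(a_x((D_x\phi^{k+1})^2)+a_y((D_y\phi^{k+1})^2)\big)-2d_x\big(A_x\kappa(\phi^{k+1})\,D_x\phi^{k+1}\big)-2d_y\big(A_y\kappa(\phi^{k+1})\,D_y\phi^{k+1}\big)+H'(\phi^k)$$ on $C_m\times C_n$, and $\mu^{k+1}$ is extended periodically to $C_{\overline m}\times C_{\overline n}$.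
   Context: In the scheme, $(r_1)_{i,j}$ and $(r_2)_{i,j}$ are standard normal random variables not depending on the unknown $\phi^{k+1}$; unique solvability is for each realization. Parameters: $\alpha=\pi\big(\sqrt{M/\pi}+N/2\big)^2$, $\beta=\alpha/\sqrt{\pi M}$, $\tau=\sqrt{\pi M}\,N$, $\rho=1+M/\tau$. For $\phi\in(0,1/\rho)\subset(0,1)$: $S(\phi)=\frac{\phi}{\tau}\ln\frac{\alpha\phi}{\tau}+\frac{\phi}{N}\ln\frac{\beta\phi}{\tau}+(1-\rho\phi)\ln(1-\rho\phi)$, $H(\phi)=\chi\phi(1-\rho\phi)$, $\kappa(\phi)=\frac{1}{36\phi(1-\phi)}$. Additive constants in $S'$ and $H'$ are dropped in the scheme (they are annihilated by $\Delta_h$), so in the scheme $S'(\phi)=\big(\frac1\tau+\frac1N\big)\ln\phi-\rho\ln(1-\rho\phi)$, $H'(\phi)=-2\chi\rho\phi$, $\kappa'(\phi)=\frac{2\phi-1}{36\phi^2(1-\phi)^2}$. Grid: $h_x=L_x/m$, $h_y=L_y/n$; $x_i=(i-\frac12)h_x$, $y_j=(j-\frac12)h_y$ (for integer or half-integer indices). $C_m=\{x_i: 1\le i\le m\}$, $C_{\overline m}=\{x_i: 0\le i\le m+1\}$, $E_m=\{x_{i+1/2}:0\le i\le m\}$; similarly $C_n,C_{\overline n},E_n$ in $y$. $\mathcal{C}_{\overline m\times\overline n}$ is the space of functions $\phi:C_{\overline m}\times C_{\overline n}\to\mathbb{R}$, $\phi_{i,j}=\phi(x_i,y_j)$. Such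 $\phi$ is periodic if $\phi_{m+1,j}=\phi_{1,j}$, $\phi_{0,j}=\phi_{m,j}$ for $1\le j\le n$ and $\phi_{i,n+1}=\phi_{i,1}$, $\phi_{i,0}=\phi_{i,n}$ for $0\le i\le m+1$. Operators. For $f$ defined on $E_m\times C_n$: $a_xf_{i,j}=\frac12(f_{i+\frac12,j}+f_{i-\frac12,j})$, $d_xf_{i,j}=\frac1{h_x}(f_{i+\frac12,j}-f_{i-\frac12,j})$, $1\le i\le m$, $1\le j\le n$. For $g$ defined on $C_m\times E_n$: $a_yg_{i,j}=\frac12(g_{i,j+\frac12}+g_{i,j-\frac12})$, $d_yg_{i,j}=\frac1{h_y}(g_{i,j+\frac12}-g_{i,j-\frac12})$. For $\phi\in\mathcal{C}_{\overline m\times\overline n}$: $A_x\phi_{i+\frac12,j}=\frac12(\phi_{i+1,j}+\phi_{i,j})$, $D_x\phi_{i+\frac12,j}=\frac1{h_x}(\phi_{i+1,j}-\phi_{i,j})$ for $0\le i\le m$, $1\le j\le n$; $A_y\phi_{i,j+\frac12}=\frac12(\phi_{i,j+1}+\phi_{i,j})$, $D_y\phi_{i,j+\frac12}=\frac1{h_y}(\phi_{i,j+1}-\phi_{i,j})$ for $1\le i\le m$, $0\le j\le n$; and $\Delta_h\phi_{i,j}=d_x(D_x\phi)_{i,j}+d_y(D_y\phi)_{i,j}$ for $1\le i\le m$, $1\le j\le n$. Products, squares and compositions with scalar functions are taken pointwise. *)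

theory Defs
  imports Complex_Main "HOL-Library.FuncSet"
begin

subsection \<open>Parameters and constitutive functions\<close>

definition alpha :: "real \<Rightarrow> real \<Rightarrow> real" where
  "alpha M N = pi * (sqrt (M / pi) + N / 2)\<^sup>2"

definition beta :: "real \<Rightarrow> real \<Rightarrow> real" where
  "beta M N = alpha M N / sqrt (pi * M)"

definition tau :: "real \<Rightarrow> real \<Rightarrow> real" where
  "tau M N = sqrt (pi * M) * N"

definition rho :: "real \<Rightarrow> real \<Rightarrow> real" where
  "rho M N = 1 + M / tau M N"

definition S_fun :: "real \<Rightarrow> real \<Rightarrow> real \<Rightarrow> real" where
  "S_fun M N \<phi> = \<phi> / tau M N * ln (alpha M N * \<phi> / tau M N)
           + \<phi> / N * ln (beta M N * \<phi> / tau M N)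
           + (1 - rho M N * \<phi>) * ln (1 - rho M N * \<phi>)"

definition H_fun :: "real \<Rightarrow> real \<Rightarrow> real \<Rightarrow> real \<Rightarrow> real" where
  "H_fun M N \<chi> \<phi> = \<chi> * \<phi> * (1 - rho M N * \<phi>)"

definition kappa :: "real \<Rightarrow> real" where
  "kappa \<phi> = 1 / (36 * \<phi> * (1 - \<phi>))"

text \<open>
  The functions written $S'$ and $H'$ in the scheme are the derivatives of $S$ and $H$ without their
  additive constants, which the discrete Laplacian annihilates; see \<open>S_deriv\<close>, \<open>H_deriv\<close> and
  \<open>kappa_deriv\<close> below.
\<close>

definition dS :: "real \<Rightarrow> real \<Rightarrow> real \<Rightarrow> real" where
  "dS M N \<phi> = (1 / tau M N + 1 / N) * ln \<phi> - rho M N * ln (1 - rho M N * \<phi>)"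

definition dH :: "real \<Rightarrow> real \<Rightarrow> real \<Rightarrow> real \<Rightarrow> real" where
  "dH M N \<chi> \<phi> = - 2 * \<chi> * rho M N * \<phi>"

definition dkappa :: "real \<Rightarrow> real" where
  "dkappa \<phi> = (2 * \<phi> - 1) / (36 * \<phi>\<^sup>2 * (1 - \<phi>)\<^sup>2)"

lemma tau_pos: "M > 0 \<Longrightarrow> N > 0 \<Longrightarrow> tau M N > 0"
  by (simp add: tau_def)

lemma rho_gt_1: "M > 0 \<Longrightarrow> N > 0 \<Longrightarrow> rho M N > 1"
  by (simp add: rho_def tau_pos)

lemma alpha_pos: "M > 0 \<Longrightarrow> N > 0 \<Longrightarrow> alpha M N > 0"
proof -
  assume "M > 0" "N > 0"
  then have "sqrt (M / pi) + N / 2 > 0" by (simp add: add_nonneg_pos)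
  then show ?thesis by (simp add: alpha_def)
qed

lemma beta_pos: "M > 0 \<Longrightarrow> N > 0 \<Longrightarrow> beta M N > 0"
  by (simp add: beta_def alpha_pos)

lemma S_deriv:
  assumes "M > 0" "N > 0"
  shows "\<exists>c. \<forall>\<phi>\<in>{0<..<1 / rho M N}. (S_fun M N has_real_derivative dS M N \<phi> + c) (at \<phi>)"
proof -
  define t a b r where "t = tau M N" and "a = alpha M N" and "b = beta M N" and "r = rho M N"
  have pos: "t > 0" "a > 0" "b > 0" "r > 0" "N > 0"
    using assms tau_pos alpha_pos beta_pos rho_gt_1[of M N]
    by (auto simp: t_def a_def b_def r_def)
  define c where "c = (ln a - ln t + 1) / t + (ln b - ln t + 1) / N - r"
  have "(S_fun M N has_real_derivative dS M N x + c) (at x)" if x: "x \<in> {0<..<1 / r}" for x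
  proof -
    have x0: "x > 0" and x1: "1 - r * x > 0"
      using x pos by (auto simp: field_simps)
    have S: "S_fun M N = (\<lambda>\<phi>. \<phi> / t * ln (a * \<phi> / t) + \<phi> / N * ln (b * \<phi> / t)
        + (1 - r * \<phi>) * ln (1 - r * \<phi>))"
      by (auto simp: S_fun_def t_def a_def b_def r_def)
    have la: "ln (a * x / t) = ln a + ln x - ln t" "ln (b * x / t) = ln b + ln x - ln t"
      using pos x0 by (simp_all add: ln_mult ln_div)
    have dS: "dS M N x = (1 / t + 1 / N) * ln x - r * ln (1 - r * x)"
      by (simp add: dS_def t_def r_def)
    have 1: "((\<lambda>\<phi>. \<phi> / d * ln (k * \<phi> / t)) has_real_derivative
        1 / d * ln (k * x / t) + x / d * (k / t / (k * x / t))) (at x)" if "d > 0" "k > 0" for d k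
      using that pos x0 by (auto intro!: derivative_eq_intros simp: add_divide_distrib)
    have 2: "((\<lambda>\<phi>. (1 - r * \<phi>) * ln (1 - r * \<phi>)) has_real_derivative
        - r * ln (1 - r * x) + (1 - r * x) * (- r / (1 - r * x))) (at x)"
      using x1 by (auto intro!: derivative_eq_intros)
    have "(S_fun M N has_real_derivative
        (1 / t * ln (a * x / t) + x / t * (a / t / (a * x / t))
        + (1 / N * ln (b * x / t) + x / N * (b / t / (b * x / t)))
        + (- r * ln (1 - r * x) + (1 - r * x) * (- r / (1 - r * x))))) (at x)"
      unfolding S using pos by (intro DERIV_add 1 2)
    also have "(1 / t * ln (a * x / t) + x / t * (a / t / (a * x / t))
        + (1 / N * ln (b * x / t) + x / N * (b / t / (b * x / t)))
        + (- r * ln (1 - r * x) + (1 - r * x) * (- r / (1 - r * x)))) = dS M N x + c"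
    proof -
      have "(1 - r * x) * (- r / (1 - r * x)) = - r"
        using x1 by simp
      moreover have "x / t * (a / t / (a * x / t)) = 1 / t" "x / N * (b / t / (b * x / t)) = 1 / N"
        using pos x0 by simp_all
      ultimately show ?thesis
        unfolding la dS c_def by (simp add: add_divide_distrib diff_divide_distrib algebra_simps)
    qed
    finally show ?thesis .
  qed
  then show ?thesis unfolding r_def by blast
qed

lemma H_deriv:
  "(H_fun M N \<chi> has_real_derivative dH M N \<chi> \<phi> + \<chi>) (at \<phi>)"
proof -
  have "((\<lambda>\<phi>. \<chi> * \<phi> * (1 - rho M N * \<phi>)) has_real_derivative dH M N \<chi> \<phi> + \<chi>) (at \<phi>)"
    by (auto intro!: derivative_eq_intros simp: dH_def algebra_simps)
  then show ?thesis by (simp add: H_fun_def [abs_def])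
qed

lemma kappa_deriv:
  assumes "0 < \<phi>" "\<phi> < 1"
  shows "(kappa has_real_derivative dkappa \<phi>) (at \<phi>)"
proof -
  have "((\<lambda>\<phi>. 1 / (36 * \<phi> * (1 - \<phi>))) has_real_derivative dkappa \<phi>) (at \<phi>)"
    using assms
    by (auto intro!: derivative_eq_intros simp: dkappa_def divide_simps power2_eq_square)
      (simp add: algebra_simps)
  then show ?thesis by (simp add: kappa_def [abs_def])
qed

subsection \<open>Grid functions\<close>

text \<open>
  A grid function is represented by its array of values: \<open>\<phi> (i, j)\<close> is $\phi(x_i, y_j)$ for
  $0 \le i \le m+1$, $0 \le j \le n+1$. A function on the vertical edges $E_m \times C_n$ is
  represented with the index shifted down by one half, so that \<open>f (i, j)\<close> is $f_{i+1/2,j}$ for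
  $0 \le i \le m$; likewise \<open>g (i, j)\<close> is $g_{i,j+1/2}$ on $C_m \times E_n$. The operators \<open>a_x\<close>,
  \<open>d_x\<close> are meaningful for $i \ge 1$ and \<open>a_y\<close>, \<open>d_y\<close> for $j \ge 1$, where the subtraction of natural
  numbers does not truncate.
\<close>

definition cells :: "nat \<Rightarrow> nat \<Rightarrow> (nat \<times> nat) set" where
  "cells m n = {1..m} \<times> {1..n}"

definition grid :: "nat \<Rightarrow> nat \<Rightarrow> (nat \<times> nat) set" where
  "grid m n = {0..m + 1} \<times> {0..n + 1}"

text \<open>
  Grid functions have the fixed value \<open>undefined\<close> off the grid, so that equality of grid functions is
  equality of their values on the grid.
\<close>

definition grid_fun :: "nat \<Rightarrow> nat \<Rightarrow> (nat \<times> nat \<Rightarrow> real) set" where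
  "grid_fun m n = grid m n \<rightarrow>\<^sub>E UNIV"

definition periodic_grid :: "nat \<Rightarrow> nat \<Rightarrow> (nat \<times> nat \<Rightarrow> real) \<Rightarrow> bool" where
  "periodic_grid m n \<phi> \<longleftrightarrow>
     (\<forall>j\<in>{1..n}. \<phi> (m + 1, j) = \<phi> (1, j) \<and> \<phi> (0, j) = \<phi> (m, j)) \<and>
     (\<forall>i\<in>{0..m + 1}. \<phi> (i, n + 1) = \<phi> (i, 1) \<and> \<phi> (i, 0) = \<phi> (i, n))"

definition wrap :: "nat \<Rightarrow> nat \<Rightarrow> nat" where
  "wrap m i = (if i = 0 then m else if i = m + 1 then 1 else i)"

definition periodic_ext :: "nat \<Rightarrow> nat \<Rightarrow> (nat \<times> nat \<Rightarrow> real) \<Rightarrow> (nat \<times> nat \<Rightarrow> real)" where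
  "periodic_ext m n f = (\<lambda>(i, j)\<in>grid m n. f (wrap m i, wrap n j))"

lemma periodic_ext_cells: "p \<in> cells m n \<Longrightarrow> periodic_ext m n f p = f p"
  by (auto simp: periodic_ext_def cells_def grid_def wrap_def)

lemma periodic_ext_grid_fun: "periodic_ext m n f \<in> grid_fun m n"
  by (auto simp: periodic_ext_def grid_fun_def)

lemma periodic_ext_periodic:
  assumes "m > 0" "n > 0"
  shows "periodic_grid m n (periodic_ext m n f)"
  using assms by (auto simp: periodic_ext_def periodic_grid_def grid_def wrap_def)

subsection \<open>Difference and averaging operators\<close>

definition a_x :: "(nat \<times> nat \<Rightarrow> real) \<Rightarrow> (nat \<times> nat \<Rightarrow> real)" where
  "a_x f = (\<lambda>(i, j). (f (i, j) + f (i - 1, j)) / 2)"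

definition d_x :: "real \<Rightarrow> (nat \<times> nat \<Rightarrow> real) \<Rightarrow> (nat \<times> nat \<Rightarrow> real)" where
  "d_x hx f = (\<lambda>(i, j). (f (i, j) - f (i - 1, j)) / hx)"

definition a_y :: "(nat \<times> nat \<Rightarrow> real) \<Rightarrow> (nat \<times> nat \<Rightarrow> real)" where
  "a_y g = (\<lambda>(i, j). (g (i, j) + g (i, j - 1)) / 2)"

definition d_y :: "real \<Rightarrow> (nat \<times> nat \<Rightarrow> real) \<Rightarrow> (nat \<times> nat \<Rightarrow> real)" where
  "d_y hy g = (\<lambda>(i, j). (g (i, j) - g (i, j - 1)) / hy)"

definition A_x :: "(nat \<times> nat \<Rightarrow> real) \<Rightarrow> (nat \<times> nat \<Rightarrow> real)" where
  "A_x \<phi> = (\<lambda>(i, j). (\<phi> (i + 1, j) + \<phi> (i, j)) / 2)"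

definition D_x :: "real \<Rightarrow> (nat \<times> nat \<Rightarrow> real) \<Rightarrow> (nat \<times> nat \<Rightarrow> real)" where
  "D_x hx \<phi> = (\<lambda>(i, j). (\<phi> (i + 1, j) - \<phi> (i, j)) / hx)"

definition A_y :: "(nat \<times> nat \<Rightarrow> real) \<Rightarrow> (nat \<times> nat \<Rightarrow> real)" where
  "A_y \<phi> = (\<lambda>(i, j). (\<phi> (i, j + 1) + \<phi> (i, j)) / 2)"

definition D_y :: "real \<Rightarrow> (nat \<times> nat \<Rightarrow> real) \<Rightarrow> (nat \<times> nat \<Rightarrow> real)" where
  "D_y hy \<phi> = (\<lambda>(i, j). (\<phi> (i, j + 1) - \<phi> (i, j)) / hy)"

definition laplace_h :: "real \<Rightarrow> real \<Rightarrow> (nat \<times> nat \<Rightarrow> real) \<Rightarrow> (nat \<times> nat \<Rightarrow> real)" where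
  "laplace_h hx hy \<phi> = (\<lambda>p. d_x hx (D_x hx \<phi>) p + d_y hy (D_y hy \<phi>) p)"

subsection \<open>The scheme\<close>

definition noise :: "real \<Rightarrow> real \<Rightarrow> real \<Rightarrow> nat \<Rightarrow> nat \<Rightarrow>
    (nat \<times> nat \<Rightarrow> real) \<Rightarrow> (nat \<times> nat \<Rightarrow> real) \<Rightarrow> (nat \<times> nat \<Rightarrow> real)" where
  "noise hx hy s m n r1 r2 = (\<lambda>p. - (sqrt 2 / sqrt (hx * hy * s)) *
     (a_x (D_x hx (periodic_ext m n r1)) p + a_y (D_y hy (periodic_ext m n r2)) p))"

definition mu :: "real \<Rightarrow> real \<Rightarrow> real \<Rightarrow> real \<Rightarrow> real \<Rightarrow>
    (nat \<times> nat \<Rightarrow> real) \<Rightarrow> (nat \<times> nat \<Rightarrow> real) \<Rightarrow> (nat \<times> nat \<Rightarrow> real)" where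
  "mu M N \<chi> hx hy \<phi>old \<phi> = (\<lambda>p.
     dS M N (\<phi> p)
     + dkappa (\<phi> p) * (a_x (\<lambda>q. (D_x hx \<phi> q)\<^sup>2) p + a_y (\<lambda>q. (D_y hy \<phi> q)\<^sup>2) p)
     - 2 * d_x hx (\<lambda>q. A_x (\<lambda>u. kappa (\<phi> u)) q * D_x hx \<phi> q) p
     - 2 * d_y hy (\<lambda>q. A_y (\<lambda>u. kappa (\<phi> u)) q * D_y hy \<phi> q) p
     + dH M N \<chi> (\<phi>old p))"

definition admissible :: "real \<Rightarrow> real \<Rightarrow> nat \<Rightarrow> nat \<Rightarrow> (nat \<times> nat \<Rightarrow> real) \<Rightarrow> bool" where
  "admissible M N m n \<phi> \<longleftrightarrow>
     \<phi> \<in> grid_fun m n \<and> periodic_grid m n \<phi> \<and> (\<forall>p\<in>grid m n. 0 < \<phi> p \<and> \<phi> p < 1 / rho M N)"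

end

theory Submission
  imports Defs "HOL-Analysis.Function_Topology"
begin

text \<open>
  The periodic grid is a connected weighted graph on which \<open>\<Delta>\<^sub>h\<close> is the graph Laplacian, and the implicit
  part of $\mu$ is the gradient of an energy built from $S$ and from the edge terms
  $\frac12(\kappa(a)+\kappa(b))(a-b)^2$, which are convex since $1/\kappa$ is concave.

  Uniqueness: for two solutions with potential difference $\nu$, testing the difference of the two
  equations with $\nu$ gives a nonpositive number, whereas strict monotonicity of the gradient makes it
  positive unless the solutions agree.

  Existence: instead of an $H^{-1}$ norm, which would require solving a discrete Poisson problem, one
  minimises over fluxes $J$ the kinetic cost $s\sum c J^2$ plus the energy of the state
  $w + s\,\mathrm{div}\,J$, with all states constrained to $[\delta, u-\delta]$. At an
  unconstrained minimiser $J_{pq} = (\mu_q-\mu_p)/2$, and the definition of the state becomes the scheme. The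
  constraint is inactive for small $\delta$: moving mass along a path from the maximum point of a
  minimiser to its minimum point cannot decrease the cost, and as the edge terms have a favourable sign
  there, this bounds the difference of $S'$ at the two points independently of $\delta$, while $S'$ is
  infinite at both ends of the interval.
\<close>

subsection \<open>Weighted graphs\<close>

text \<open>Loops are allowed because a grid direction with a single cell produces them.
  Connectedness is what makes every zero-sum function a divergence, see
  \<open>ex_flux\<close>.\<close>

locale weighted_graph =
  fixes V :: "'v set" and c :: "'v \<Rightarrow> 'v \<Rightarrow> real"
  assumes finite_V: "finite V" and V_nonempty: "V \<noteq> {}"
    and c_nonneg: "c p q \<ge> 0" and c_sym: "p \<in> V \<Longrightarrow> q \<in> V \<Longrightarrow> c p q = c q p"
    and connected: "p \<in> V \<Longrightarrow> q \<in> V \<Longrightarrow> (p, q) \<in> {(x, y). x \<in> V \<and> y \<in> V \<and> c x y > 0}\<^sup>*"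
begin

definition edges :: "('v \<times> 'v) set" where
  "edges = {(x, y). x \<in> V \<and> y \<in> V \<and> c x y > 0}"

lemma finite_edges: "finite edges"
  by (rule finite_subset[of _ "V \<times> V"]) (auto simp: edges_def finite_V)

definition lap :: "('v \<Rightarrow> real) \<Rightarrow> 'v \<Rightarrow> real" where
  "lap f p = (\<Sum>q\<in>V. c p q * (f q - f p))"

lemma lap_cong:
  assumes "\<And>q. q \<in> V \<Longrightarrow> f q = h q" "p \<in> V"
  shows "lap f p = lap h p"
  using assms by (simp add: lap_def cong: sum.cong)

text \<open>
  A flux is not required to be antisymmetric: only the difference of its values on an edge and on
  the reversed edge is transported.
\<close>

definition dvg :: "('v \<times> 'v \<Rightarrow> real) \<Rightarrow> 'v \<Rightarrow> real" where
  "dvg J p = (\<Sum>q\<in>V. c p q * (J (p, q) - J (q, p)))"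

lemma sum_swap_c: "(\<Sum>p\<in>V. \<Sum>q\<in>V. c p q * f p q) = (\<Sum>p\<in>V. \<Sum>q\<in>V. c p q * f q p)"
  by (subst sum.swap) (intro sum.cong refl, simp add: c_sym)

text \<open>Summation by parts: average the double sum with its image under exchanging the
  endpoints. For \<open>g = f\<close> the right side is minus a Dirichlet form, hence
  nonpositive.\<close>

lemma sum_lap_mult: "(\<Sum>p\<in>V. lap f p * g p) = - (\<Sum>p\<in>V. \<Sum>q\<in>V. c p q * ((f q - f p) * (g q - g p))) / 2"
proof -
  have "(\<Sum>p\<in>V. lap f p * g p) = (\<Sum>p\<in>V. \<Sum>q\<in>V. c p q * ((f q - f p) * g p))"
    by (simp add: lap_def sum_distrib_right mult.assoc)
  moreover have "\<dots> = (\<Sum>p\<in>V. \<Sum>q\<in>V. c p q * ((f p - f q) * g q))"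
    by (rule sum_swap_c)
  moreover have "(\<Sum>p\<in>V. \<Sum>q\<in>V. c p q * ((f q - f p) * g p)) + (\<Sum>p\<in>V. \<Sum>q\<in>V. c p q * ((f p - f q) * g q))
     = - (\<Sum>p\<in>V. \<Sum>q\<in>V. c p q * ((f q - f p) * (g q - g p)))"
    unfolding sum.distrib[symmetric] sum_negf[symmetric]
    by (intro sum.cong refl) (simp add: algebra_simps)
  ultimately show ?thesis by linarith
qed

lemma dvg_add: "dvg (\<lambda>e. J e + K e) p = dvg J p + dvg K p"
  by (simp add: dvg_def sum.distrib[symmetric] algebra_simps)

lemma dvg_scale: "dvg (\<lambda>e. t * J e) p = t * dvg J p"
  by (simp add: dvg_def sum_distrib_left algebra_simps)

lemma dvg_sum: "finite I \<Longrightarrow> dvg (\<lambda>e. \<Sum>i\<in>I. J i e) p = (\<Sum>i\<in>I. dvg (J i) p)"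
  by (induction I rule: finite_induct) (simp_all add: dvg_add, simp add: dvg_def)

lemma sum_dvg: "(\<Sum>p\<in>V. dvg J p) = 0"
proof -
  have "(\<Sum>p\<in>V. dvg J p) = (\<Sum>p\<in>V. \<Sum>q\<in>V. c p q * J (p, q)) - (\<Sum>p\<in>V. \<Sum>q\<in>V. c p q * J (q, p))"
    by (simp add: dvg_def sum_subtractf[symmetric] right_diff_distrib)
  then show ?thesis using sum_swap_c[of "\<lambda>p q. J (p, q)"] by simp
qed

section \<open>Fluxes with prescribed divergence\<close>

text \<open>Dividing by the weight makes the divergence a unit dipole that brings mass to
  \<open>y\<close> and takes it from \<open>z\<close>.\<close>

definition edge_flux :: "'v \<Rightarrow> 'v \<Rightarrow> 'v \<times> 'v \<Rightarrow> real" where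
  "edge_flux y z e = (if e = (y, z) then 1 / c y z else 0)"

lemma dvg_edge_flux:
  assumes "(y, z) \<in> edges" "x \<in> V"
  shows "dvg (edge_flux y z) x = of_bool (x = y) - of_bool (x = z)"
proof -
  have yz: "y \<in> V" "z \<in> V" "c y z > 0" "c z y = c y z"
    using assms c_sym by (auto simp: edges_def)
  have "dvg (edge_flux y z) x = (\<Sum>q\<in>V. (if q = z then of_bool (x = y) else 0) - (if q = y then of_bool (x = z) else 0))"
    unfolding dvg_def by (intro sum.cong refl) (use yz in \<open>auto simp: edge_flux_def\<close>)
  also have "\<dots> = of_bool (x = y) - of_bool (x = z)"
    using yz finite_V by (simp add: sum_subtractf)
  finally show ?thesis .
qed

lemma edge_flux_off_edges: "(y, z) \<in> edges \<Longrightarrow> e \<notin> edges \<Longrightarrow> edge_flux y z e = 0"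
  by (auto simp: edge_flux_def)

text \<open>Add edge fluxes along a path from \<open>p\<close> to \<open>q\<close>; the dipoles
  telescope.\<close>

lemma ex_path_flux:
  assumes "p \<in> V" "q \<in> V"
  shows "\<exists>J. (\<forall>e. e \<notin> edges \<longrightarrow> J e = 0) \<and> (\<forall>x\<in>V. dvg J x = of_bool (x = p) - of_bool (x = q))"
proof -
  have "(p, q) \<in> edges\<^sup>*" using connected[OF assms] by (simp add: edges_def)
  then show ?thesis
  proof (induction rule: rtrancl_induct)
    case base
    show ?case by (rule exI[of _ "\<lambda>_. 0"]) (simp add: dvg_def)
  next
    case (step y z)
    then obtain J where "\<forall>e. e \<notin> edges \<longrightarrow> J e = 0" "\<forall>x\<in>V. dvg J x = of_bool (x = p) - of_bool (x = y)"
      by blast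
    then show ?case using step(2)
      by (intro exI[of _ "\<lambda>e. J e + edge_flux y z e"]) (simp add: dvg_add dvg_edge_flux edge_flux_off_edges)
  qed
qed

text \<open>Exchange the amount \<open>g p\<close> between each \<open>p\<close> and a fixed root
  \<open>r\<close> along a path. The contributions at the root add up to the total of
  \<open>g\<close>, which is zero.\<close>

lemma ex_flux:
  assumes "(\<Sum>p\<in>V. g p) = 0"
  shows "\<exists>J. (\<forall>e. e \<notin> edges \<longrightarrow> J e = 0) \<and> (\<forall>x\<in>V. dvg J x = g x)"
proof -
  obtain r where r: "r \<in> V" using V_nonempty by blast
  have "\<forall>p. \<exists>J. p \<in> V \<longrightarrow> (\<forall>e. e \<notin> edges \<longrightarrow> J e = 0) \<and> (\<forall>x\<in>V. dvg J x = of_bool (x = p) - of_bool (x = r))"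
    using ex_path_flux r by blast
  then obtain J where J: "\<And>p e. p \<in> V \<Longrightarrow> e \<notin> edges \<Longrightarrow> J p e = 0"
    "\<And>p x. p \<in> V \<Longrightarrow> x \<in> V \<Longrightarrow> dvg (J p) x = of_bool (x = p) - of_bool (x = r)"
    by metis
  define K where "K = (\<lambda>e. \<Sum>p\<in>V. g p * J p e)"
  have "dvg K x = g x" if "x \<in> V" for x
  proof -
    have "dvg K x = (\<Sum>p\<in>V. g p * (of_bool (x = p) - of_bool (x = r)))"
      unfolding K_def using finite_V that by (simp add: dvg_sum dvg_scale J(2))
    also have "\<dots> = (\<Sum>p\<in>V. if x = p then g p else 0) - (\<Sum>p\<in>V. g p) * of_bool (x = r)"
      unfolding sum_distrib_right sum_subtractf[symmetric] by (intro sum.cong refl) auto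
    finally show ?thesis using assms that finite_V by simp
  qed
  moreover have "K e = 0" if "e \<notin> edges" for e
    unfolding K_def using J(1) that by (intro sum.neutral) auto
  ultimately show ?thesis by blast
qed

end

section \<open>Feasible directions and one-sided minima\<close>

text \<open>Continuity settles an endpoint that differs from \<open>x\<close>; at an endpoint equal
  to \<open>x\<close> the direction must not point outwards.\<close>

lemma eventually_in_interval:
  fixes x v a b :: real
  assumes "a < b" "x \<in> {a..b}" "x = a \<Longrightarrow> v \<ge> 0" "x = b \<Longrightarrow> v \<le> 0"
  shows "eventually (\<lambda>t. x + t * v \<in> {a..b}) (at_right 0)"
proof -
  have lim: "((\<lambda>t. x + t * v) \<longlongrightarrow> x) (at_right 0)"
    by (auto intro!: tendsto_eq_intros)
  have pos: "eventually (\<lambda>t::real. t > 0) (at_right 0)"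
    by (rule eventually_at_right_less)
  have "eventually (\<lambda>t. a \<le> x + t * v) (at_right 0)"
  proof (cases "x = a")
    case True
    show ?thesis using pos by eventually_elim (use True assms(3) in simp)
  next
    case False
    then have "a < x" using assms(2) by auto
    from order_tendstoD(1)[OF lim this] show ?thesis by eventually_elim simp
  qed
  moreover have "eventually (\<lambda>t. x + t * v \<le> b) (at_right 0)"
  proof (cases "x = b")
    case True
    show ?thesis using pos by eventually_elim (use True assms(4) in \<open>simp add: mult_nonneg_nonpos\<close>)
  next
    case False
    then have "x < b" using assms(2) by auto
    from order_tendstoD(2)[OF lim this] show ?thesis by eventually_elim simp
  qed
  ultimately show ?thesis by eventually_elim simp
qed

lemma DERIV_nonneg_right_min:
  fixes f :: "real \<Rightarrow> real"
  assumes "(f has_real_derivative D) (at 0)" "eventually (\<lambda>t. f 0 \<le> f t) (at_right 0)"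
  shows "D \<ge> 0"
proof (rule tendsto_lowerbound)
  show "((\<lambda>t. (f t - f 0) / t) \<longlongrightarrow> D) (at_right 0)"
    using assms(1) by (auto simp: has_field_derivative_iff intro: tendsto_mono[OF at_le[of "{0<..}" UNIV]])
  show "eventually (\<lambda>t. 0 \<le> (f t - f 0) / t) (at_right 0)"
    using assms(2) eventually_at_right_less[of 0] by eventually_elim simp
qed simp


subsection \<open>Implicit gradient flow on a weighted graph\<close>

text \<open>\<open>H\<close> is the explicit part of the potential: it is frozen during the step and
  enters the energy linearly. \<open>S\<close> and \<open>\<kappa>\<close> are controlled only
  inside the open interval; the blow-up of \<open>dS\<close> at its ends is what keeps minimisers
  inside.\<close>

locale gradient_flow = weighted_graph V c for V :: "'v set" and c +
  fixes u :: real and S dS \<kappa> d\<kappa> :: "real \<Rightarrow> real" and H :: "'v \<Rightarrow> real"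
  assumes u_pos: "u > 0"
    and S_deriv: "0 < x \<Longrightarrow> x < u \<Longrightarrow> (S has_real_derivative dS x) (at x)"
    and dS_strict_mono: "0 < x \<Longrightarrow> x < y \<Longrightarrow> y < u \<Longrightarrow> dS x < dS y"
    and dS_at_0: "filterlim dS at_bot (at_right 0)"
    and dS_at_u: "filterlim dS at_top (at_left u)"
    and \<kappa>_nonneg: "0 < x \<Longrightarrow> x < u \<Longrightarrow> \<kappa> x \<ge> 0"
    and \<kappa>_deriv: "0 < x \<Longrightarrow> x < u \<Longrightarrow> (\<kappa> has_real_derivative d\<kappa> x) (at x)"
      \<comment> \<open>the tangent plane inequality of the convex function \<open>(a, z) \<mapsto> \<kappa> a * z\<^sup>2\<close>\<close>
    and \<kappa>_perspective: "0 < a \<Longrightarrow> a < u \<Longrightarrow> 0 < a' \<Longrightarrow> a' < u \<Longrightarrow>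
      \<kappa> a' * z'\<^sup>2 \<ge> \<kappa> a * z\<^sup>2 + d\<kappa> a * z\<^sup>2 * (a' - a) + 2 * \<kappa> a * z * (z' - z)"
begin

text \<open>Edge discretisation of \<kappa>(\<phi>) times the squared gradient; the factor 1/h^2
  sits in the weight \<open>c\<close>.\<close>

definition pair_energy :: "real \<Rightarrow> real \<Rightarrow> real" where
  "pair_energy a b = (\<kappa> a + \<kappa> b) / 2 * (a - b)\<^sup>2"

text \<open>The partial derivative of \<open>pair_energy\<close> in its first argument.\<close>

definition d_pair_energy :: "real \<Rightarrow> real \<Rightarrow> real" where
  "d_pair_energy a b = d\<kappa> a / 2 * (b - a)\<^sup>2 - (\<kappa> a + \<kappa> b) * (b - a)"

definition \<mu> :: "('v \<Rightarrow> real) \<Rightarrow> 'v \<Rightarrow> real" where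
  "\<mu> \<phi> p = dS (\<phi> p) + (\<Sum>q\<in>V. c p q * d_pair_energy (\<phi> p) (\<phi> q)) + H p"

text \<open>The double sum is halved because it meets every edge in both directions.\<close>

definition energy :: "('v \<Rightarrow> real) \<Rightarrow> real" where
  "energy \<phi> = (\<Sum>p\<in>V. S (\<phi> p) + H p * \<phi> p) + (\<Sum>p\<in>V. \<Sum>q\<in>V. c p q * pair_energy (\<phi> p) (\<phi> q)) / 2"

lemma \<mu>_cong:
  assumes "\<And>q. q \<in> V \<Longrightarrow> \<phi> q = \<psi> q" "p \<in> V"
  shows "\<mu> \<phi> p = \<mu> \<psi> p"
  using assms by (simp add: \<mu>_def cong: sum.cong)

section \<open>Monotonicity of the gradient and uniqueness\<close>

lemma dS_mono: "0 < x \<Longrightarrow> x \<le> y \<Longrightarrow> y < u \<Longrightarrow> dS x \<le> dS y"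
  using dS_strict_mono[of x y] by (cases "x = y") auto

text \<open>With both slopes equal to 1 the tangent plane inequality says that
  \<open>\<kappa>\<close> is convex; add its two instances at \<open>x\<close> and
  \<open>y\<close>.\<close>

lemma d\<kappa>_mono:
  assumes "0 < x" "x \<le> y" "y < u"
  shows "d\<kappa> x \<le> d\<kappa> y"
proof (cases "x = y")
  case False
  have "\<kappa> y \<ge> \<kappa> x + d\<kappa> x * (y - x)" "\<kappa> x \<ge> \<kappa> y + d\<kappa> y * (x - y)"
    using \<kappa>_perspective[of x y 1 1] \<kappa>_perspective[of y x 1 1] assms by auto
  then have "(d\<kappa> y - d\<kappa> x) * (y - x) \<ge> 0" by (simp add: algebra_simps)
  then show ?thesis using False assms by (simp add: zero_le_mult_iff)
qed simp

text \<open>Gradients of convex functions are monotone. The pair energy is half the sum of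
  \<open>\<kappa> a * y\<^sup>2\<close> and \<open>\<kappa> b * y\<^sup>2\<close> with
  \<open>y = a - b\<close>, and each summand is a convex function composed with a linear
  map.\<close>

lemma d_pair_energy_monotone:
  assumes "0 < a" "a < u" "0 < b" "b < u" "0 < a'" "a' < u" "0 < b'" "b' < u"
  shows "(d_pair_energy a b - d_pair_energy a' b') * (a - a') + (d_pair_energy b a - d_pair_energy b' a') * (b - b') \<ge> 0"
proof -
  define y z where "y = a - b" and "z = a' - b'"
  \<comment> \<open>Monotonicity for one endpoint: the sum of the tangent plane inequalities at
    \<open>(x, y)\<close> and at \<open>(x', z)\<close>.\<close>
  have vertex: "(d\<kappa> x * y\<^sup>2 - d\<kappa> x' * z\<^sup>2) * (x - x') + 2 * (\<kappa> x * y - \<kappa> x' * z) * (y - z) \<ge> 0"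
    if "0 < x" "x < u" "0 < x'" "x' < u" for x x'
    using \<kappa>_perspective[of x x' y z] \<kappa>_perspective[of x' x z y] that
    by (simp add: algebra_simps power2_eq_square)
  have g_eq: "2 * d_pair_energy a b = d\<kappa> a * y\<^sup>2 + 2 * ((\<kappa> a + \<kappa> b) * y)"
    "2 * d_pair_energy b a = d\<kappa> b * y\<^sup>2 - 2 * ((\<kappa> a + \<kappa> b) * y)"
    "2 * d_pair_energy a' b' = d\<kappa> a' * z\<^sup>2 + 2 * ((\<kappa> a' + \<kappa> b') * z)"
    "2 * d_pair_energy b' a' = d\<kappa> b' * z\<^sup>2 - 2 * ((\<kappa> a' + \<kappa> b') * z)"
    by (simp_all add: d_pair_energy_def y_def z_def power2_commute algebra_simps)
  have "2 * ((d_pair_energy a b - d_pair_energy a' b') * (a - a') + (d_pair_energy b a - d_pair_energy b' a') * (b - b')) =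
    (2 * d_pair_energy a b - 2 * d_pair_energy a' b') * (a - a') + (2 * d_pair_energy b a - 2 * d_pair_energy b' a') * (b - b')"
    by (simp add: algebra_simps)
  also have "\<dots> =
    (d\<kappa> a * y\<^sup>2 - d\<kappa> a' * z\<^sup>2) * (a - a') + (d\<kappa> b * y\<^sup>2 - d\<kappa> b' * z\<^sup>2) * (b - b')
    + 2 * ((\<kappa> a + \<kappa> b) * y - (\<kappa> a' + \<kappa> b') * z) * ((a - a') - (b - b'))"
    unfolding g_eq by (simp add: algebra_simps)
  also have "(a - a') - (b - b') = y - z" by (simp add: y_def z_def)
  also have "2 * ((\<kappa> a + \<kappa> b) * y - (\<kappa> a' + \<kappa> b') * z) * (y - z) =
    2 * (\<kappa> a * y - \<kappa> a' * z) * (y - z) + 2 * (\<kappa> b * y - \<kappa> b' * z) * (y - z)"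
    by (simp add: algebra_simps)
  also have "(d\<kappa> a * y\<^sup>2 - d\<kappa> a' * z\<^sup>2) * (a - a') + (d\<kappa> b * y\<^sup>2 - d\<kappa> b' * z\<^sup>2) * (b - b') + \<dots> =
    ((d\<kappa> a * y\<^sup>2 - d\<kappa> a' * z\<^sup>2) * (a - a') + 2 * (\<kappa> a * y - \<kappa> a' * z) * (y - z)) +
    ((d\<kappa> b * y\<^sup>2 - d\<kappa> b' * z\<^sup>2) * (b - b') + 2 * (\<kappa> b * y - \<kappa> b' * z) * (y - z))"
    by (simp only: ac_simps)
  also have "\<dots> \<ge> 0"
    using vertex[OF assms(1,2,5,6)] vertex[OF assms(3,4,7,8)] by (rule add_nonneg_nonneg)
  finally show ?thesis by simp
qed

text \<open>\<open>H\<close> cancels in the difference. Pairing each ordered edge with its reverse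
  makes the interaction part a sum of the nonnegative terms of
  \<open>d_pair_energy_monotone\<close>; the \<open>dS\<close> part is kept for strictness.\<close>

lemma \<mu>_monotone:
  assumes "\<And>p. p \<in> V \<Longrightarrow> 0 < \<phi> p \<and> \<phi> p < u" "\<And>p. p \<in> V \<Longrightarrow> 0 < \<psi> p \<and> \<psi> p < u"
  shows "(\<Sum>p\<in>V. (\<mu> \<phi> p - \<mu> \<psi> p) * (\<phi> p - \<psi> p)) \<ge> (\<Sum>p\<in>V. (dS (\<phi> p) - dS (\<psi> p)) * (\<phi> p - \<psi> p))"
proof -
  let ?G = "\<lambda>p q. (d_pair_energy (\<phi> p) (\<phi> q) - d_pair_energy (\<psi> p) (\<psi> q)) * (\<phi> p - \<psi> p)"
  have "(\<Sum>p\<in>V. (\<mu> \<phi> p - \<mu> \<psi> p) * (\<phi> p - \<psi> p)) =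
    (\<Sum>p\<in>V. (dS (\<phi> p) - dS (\<psi> p)) * (\<phi> p - \<psi> p) + (\<Sum>q\<in>V. c p q * ?G p q))"
    by (intro sum.cong refl)
      (simp add: \<mu>_def left_diff_distrib right_diff_distrib distrib_left distrib_right sum_subtractf sum_distrib_right mult.assoc)
  moreover have "(\<Sum>p\<in>V. \<Sum>q\<in>V. c p q * (?G p q + ?G q p)) = 2 * (\<Sum>p\<in>V. \<Sum>q\<in>V. c p q * ?G p q)"
    using sum_swap_c[of ?G] by (simp add: distrib_left sum.distrib)
  moreover have "(\<Sum>p\<in>V. \<Sum>q\<in>V. c p q * (?G p q + ?G q p)) \<ge> 0"
    using assms by (intro sum_nonneg mult_nonneg_nonneg c_nonneg d_pair_energy_monotone) auto
  ultimately show ?thesis by (simp add: sum.distrib)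
qed

lemma unique_solution:
  assumes "s > 0"
    and \<phi>: "\<And>p. p \<in> V \<Longrightarrow> 0 < \<phi> p \<and> \<phi> p < u" "\<And>p. p \<in> V \<Longrightarrow> \<phi> p = w p + s * lap (\<mu> \<phi>) p"
    and \<psi>: "\<And>p. p \<in> V \<Longrightarrow> 0 < \<psi> p \<and> \<psi> p < u" "\<And>p. p \<in> V \<Longrightarrow> \<psi> p = w p + s * lap (\<mu> \<psi>) p"
    and "p \<in> V"
  shows "\<phi> p = \<psi> p"
proof (rule ccontr)
  assume ne: "\<phi> p \<noteq> \<psi> p"
  define \<nu> where "\<nu> = (\<lambda>p. \<mu> \<phi> p - \<mu> \<psi> p)"
  have pos: "(dS (\<phi> q) - dS (\<psi> q)) * (\<phi> q - \<psi> q) > 0" if "q \<in> V" "\<phi> q \<noteq> \<psi> q" for q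
    using dS_strict_mono[of "\<phi> q" "\<psi> q"] dS_strict_mono[of "\<psi> q" "\<phi> q"] that \<phi>(1)[of q] \<psi>(1)[of q]
    by (cases "\<phi> q < \<psi> q") (auto intro: mult_pos_pos mult_neg_neg)
  have "0 < (\<Sum>q\<in>V. (dS (\<phi> q) - dS (\<psi> q)) * (\<phi> q - \<psi> q))"
    using finite_V \<open>p \<in> V\<close> pos[OF \<open>p \<in> V\<close> ne]
  proof (rule sum_pos2)
    fix q assume "q \<in> V"
    then show "0 \<le> (dS (\<phi> q) - dS (\<psi> q)) * (\<phi> q - \<psi> q)"
      using pos[of q] by (cases "\<phi> q = \<psi> q") auto
  qed
  also have "\<dots> \<le> (\<Sum>q\<in>V. \<nu> q * (\<phi> q - \<psi> q))"
    unfolding \<nu>_def using \<phi>(1) \<psi>(1) by (rule \<mu>_monotone)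
  \<comment> \<open>The common datum \<open>w\<close> cancels, so the difference of the solutions is
    \<open>s * lap \<nu>\<close>.\<close>
  also have "\<dots> = s * (\<Sum>q\<in>V. lap \<nu> q * \<nu> q)"
    unfolding sum_distrib_left
  proof (intro sum.cong refl)
    fix q assume "q \<in> V"
    have "lap \<nu> q = lap (\<mu> \<phi>) q - lap (\<mu> \<psi>) q"
      by (simp add: lap_def \<nu>_def sum_subtractf[symmetric] algebra_simps)
    have "\<phi> q - \<psi> q = s * lap \<nu> q"
      unfolding \<open>lap \<nu> q = _\<close> using \<phi>(2)[OF \<open>q \<in> V\<close>] \<psi>(2)[OF \<open>q \<in> V\<close>] by (simp add: right_diff_distrib)
    then show "\<nu> q * (\<phi> q - \<psi> q) = s * (lap \<nu> q * \<nu> q)" by simp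
  qed
  also have "\<dots> \<le> 0"
  proof -
    have "0 \<le> (\<Sum>p\<in>V. \<Sum>q\<in>V. c p q * ((\<nu> q - \<nu> p) * (\<nu> q - \<nu> p)))"
      by (intro sum_nonneg mult_nonneg_nonneg[OF c_nonneg] zero_le_square)
    then show ?thesis using \<open>s > 0\<close> by (simp add: sum_lap_mult)
  qed
  finally show False by simp
qed

section \<open>The energy: lower bound and first variation\<close>

text \<open>\<open>S\<close> lies above its tangent at the midpoint since \<open>dS\<close>
  increases, the linear terms are bounded on a bounded interval, and the pair energies are
  nonnegative. The bound holds up to the ends of the interval, so flux bounds derived from it do not
  depend on the margin.\<close>

lemma energy_bounded_below:
  "\<exists>L. \<forall>\<phi>. (\<forall>p\<in>V. 0 < \<phi> p \<and> \<phi> p < u) \<longrightarrow> L \<le> energy \<phi>"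
proof -
  define a where "a = u / 2"
  have a: "0 < a" "a < u" using u_pos by (auto simp: a_def)
  have tangent: "S x \<ge> S a + dS a * (x - a)" if "0 < x" "x < u" for x
  proof (cases x a rule: linorder_cases)
    case less
    have "\<exists>z>x. z < a \<and> S a - S x = (a - x) * dS z"
      using less a that by (intro MVT2 S_deriv) auto
    then obtain z where z: "z > x" "z < a" "S a - S x = (a - x) * dS z" by blast
    have "(a - x) * dS z \<le> (a - x) * dS a" using z a that by (intro mult_left_mono dS_mono) auto
    then show ?thesis using z by (simp add: algebra_simps)
  next
    case greater
    have "\<exists>z>a. z < x \<and> S x - S a = (x - a) * dS z"
      using greater a that by (intro MVT2 S_deriv) auto
    then obtain z where z: "z > a" "z < x" "S x - S a = (x - a) * dS z" by blast
    have "(x - a) * dS z \<ge> (x - a) * dS a" using z a that by (intro mult_left_mono dS_mono) auto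
    then show ?thesis using z by (simp add: algebra_simps)
  qed simp
  define L where "L = (\<Sum>p\<in>V. S a - \<bar>dS a\<bar> * u - \<bar>H p\<bar> * u)"
  have "L \<le> energy \<phi>" if \<phi>: "\<forall>p\<in>V. 0 < \<phi> p \<and> \<phi> p < u" for \<phi>
  proof -
    have "S a - \<bar>dS a\<bar> * u - \<bar>H p\<bar> * u \<le> S (\<phi> p) + H p * \<phi> p" if "p \<in> V" for p
    proof -
      have p: "0 < \<phi> p" "\<phi> p < u" using \<phi> that by auto
      have "\<bar>dS a * (\<phi> p - a)\<bar> \<le> \<bar>dS a\<bar> * u" "\<bar>H p * \<phi> p\<bar> \<le> \<bar>H p\<bar> * u"
        unfolding abs_mult using p a by (intro mult_left_mono; simp)+
      then show ?thesis using tangent[OF p] by linarith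
    qed
    then have "L \<le> (\<Sum>p\<in>V. S (\<phi> p) + H p * \<phi> p)" unfolding L_def by (rule sum_mono)
    moreover have "0 \<le> (\<Sum>p\<in>V. \<Sum>q\<in>V. c p q * pair_energy (\<phi> p) (\<phi> q))"
      unfolding pair_energy_def using \<phi> by (intro sum_nonneg mult_nonneg_nonneg c_nonneg) (auto simp: \<kappa>_nonneg)
    ultimately show ?thesis by (simp add: energy_def)
  qed
  then show ?thesis by blast
qed

text \<open>Identifies \<open>\<mu>\<close> as the gradient: exchanging the summation indices turns
  the two partial derivatives of each pair term into twice the first, which cancels the half in
  \<open>energy\<close>.\<close>

lemma energy_deriv:
  assumes "\<And>p. p \<in> V \<Longrightarrow> 0 < \<phi> p \<and> \<phi> p < u"
  shows "((\<lambda>t. energy (\<lambda>p. \<phi> p + t * v p)) has_real_derivative (\<Sum>p\<in>V. \<mu> \<phi> p * v p)) (at 0)"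
proof -
  have chain: "((\<lambda>t. f (\<phi> p + t * v p)) has_real_derivative f' (\<phi> p) * v p) (at 0)"
    if "p \<in> V" "\<And>x. 0 < x \<Longrightarrow> x < u \<Longrightarrow> (f has_real_derivative f' x) (at x)" for f f' p
  proof -
    have "((\<lambda>t. \<phi> p + t * v p) has_real_derivative v p) (at 0)"
      by (auto intro!: derivative_eq_intros)
    moreover have "(f has_real_derivative f' (\<phi> p)) (at (\<phi> p + 0 * v p))"
      using that assms by simp
    ultimately show ?thesis by (rule DERIV_chain2[rotated])
  qed
  have dk: "((\<lambda>t. pair_energy (\<phi> p + t * v p) (\<phi> q + t * v q)) has_real_derivative
      d_pair_energy (\<phi> p) (\<phi> q) * v p + d_pair_energy (\<phi> q) (\<phi> p) * v q) (at 0)" if "p \<in> V" "q \<in> V" for p q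
  proof -
    have "((\<lambda>t. (\<kappa> (\<phi> p + t * v p) + \<kappa> (\<phi> q + t * v q)) / 2) has_real_derivative
        (d\<kappa> (\<phi> p) * v p + d\<kappa> (\<phi> q) * v q) / 2) (at 0)"
      using that by (intro DERIV_cdivide DERIV_add chain \<kappa>_deriv)
    moreover have "((\<lambda>t. (\<phi> p + t * v p - (\<phi> q + t * v q))\<^sup>2) has_real_derivative
        2 * (\<phi> p - \<phi> q) * (v p - v q)) (at 0)"
      by (auto intro!: derivative_eq_intros)
    ultimately have "((\<lambda>t. pair_energy (\<phi> p + t * v p) (\<phi> q + t * v q)) has_real_derivative
      (d\<kappa> (\<phi> p) * v p + d\<kappa> (\<phi> q) * v q) / 2 * (\<phi> p + 0 * v p - (\<phi> q + 0 * v q))\<^sup>2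
      + 2 * (\<phi> p - \<phi> q) * (v p - v q) * ((\<kappa> (\<phi> p + 0 * v p) + \<kappa> (\<phi> q + 0 * v q)) / 2)) (at 0)"
      unfolding pair_energy_def by (rule DERIV_mult)
    then show ?thesis
      by (rule DERIV_cong) (simp add: d_pair_energy_def power2_commute[of "\<phi> q" "\<phi> p"] algebra_simps add_divide_distrib diff_divide_distrib)
  qed
  have "((\<lambda>t. energy (\<lambda>p. \<phi> p + t * v p)) has_real_derivative
     (\<Sum>p\<in>V. dS (\<phi> p) * v p + H p * v p) + 
     (\<Sum>p\<in>V. \<Sum>q\<in>V. c p q * (d_pair_energy (\<phi> p) (\<phi> q) * v p + d_pair_energy (\<phi> q) (\<phi> p) * v q)) / 2) (at 0)"
    unfolding energy_def
    by (intro DERIV_add DERIV_sum DERIV_cdivide DERIV_cmult dk chain[OF _ S_deriv])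
      (auto intro!: derivative_eq_intros)
  moreover have "(\<Sum>p\<in>V. \<Sum>q\<in>V. c p q * (d_pair_energy (\<phi> p) (\<phi> q) * v p + d_pair_energy (\<phi> q) (\<phi> p) * v q)) =
     2 * (\<Sum>p\<in>V. \<Sum>q\<in>V. c p q * (d_pair_energy (\<phi> p) (\<phi> q) * v p))"
    using sum_swap_c[of "\<lambda>p q. d_pair_energy (\<phi> p) (\<phi> q) * v p"] by (simp add: distrib_left sum.distrib)
  moreover have "(\<Sum>p\<in>V. \<mu> \<phi> p * v p) = (\<Sum>p\<in>V. dS (\<phi> p) * v p + H p * v p)
     + (\<Sum>p\<in>V. \<Sum>q\<in>V. c p q * (d_pair_energy (\<phi> p) (\<phi> q) * v p))"
    unfolding sum.distrib[symmetric]
    by (intro sum.cong refl) (simp add: \<mu>_def distrib_right sum_distrib_right mult.assoc)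
  ultimately show ?thesis by simp
qed

section \<open>Minimisation over fluxes\<close>

text \<open>By \<open>sum_dvg\<close> the total mass is that of \<open>w\<close> for every flux:
  mass conservation is built in rather than imposed.\<close>

definition state :: "('v \<Rightarrow> real) \<Rightarrow> real \<Rightarrow> ('v \<times> 'v \<Rightarrow> real) \<Rightarrow> 'v \<Rightarrow> real" where
  "state w s J p = w p + s * dvg J p"

text \<open>The factor \<open>s\<close> of the kinetic term matches the one in \<open>state\<close>,
  so it drops out of the optimality condition.\<close>

definition cost :: "('v \<Rightarrow> real) \<Rightarrow> real \<Rightarrow> ('v \<times> 'v \<Rightarrow> real) \<Rightarrow> real" where
  "cost w s J = s * (\<Sum>p\<in>V. \<Sum>q\<in>V. c p q * (J (p, q))\<^sup>2) + energy (state w s J)"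

text \<open>Bounding the flux by \<open>R\<close> on edges and fixing it to 0 elsewhere gives
  compactness; \<open>ex_solution\<close> chooses \<open>R\<close> so large that the flux bound is
  never active.\<close>

definition box :: "('v \<Rightarrow> real) \<Rightarrow> real \<Rightarrow> real \<Rightarrow> real \<Rightarrow> ('v \<times> 'v \<Rightarrow> real) set" where
  "box w s R \<delta> = {J. (\<forall>e. J e \<in> (if e \<in> edges then {-R..R} else {0})) \<and> (\<forall>p\<in>V. state w s J p \<in> {\<delta>..u - \<delta>})}"

lemma continuous_on_coordinate: "continuous_on A (\<lambda>J :: 'v \<times> 'v \<Rightarrow> real. J e)"
  by (rule continuous_on_subset[OF continuous_on_product_coordinates]) simp

lemma continuous_on_state: "continuous_on A (\<lambda>J. state w s J p)"
  unfolding state_def dvg_def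
  by (intro continuous_intros continuous_on_coordinate)

text \<open>Tychonoff for a product of intervals and singletons, cut by the closed conditions on the
  finitely many states.\<close>

lemma compact_box: "compact (box w s R \<delta>)"
proof -
  let ?P = "PiE UNIV (\<lambda>e. if e \<in> edges then {-R..R} else {0})"
  have "compactin (product_topology (\<lambda>_. euclidean) UNIV) ?P"
    by (subst compactin_PiE) (auto simp: compactin_euclidean_iff)
  then have "compact ?P" by (simp add: euclidean_product_topology compactin_euclidean_iff)
  moreover have "closed {J. \<forall>p\<in>V. \<delta> \<le> state w s J p \<and> state w s J p \<le> u - \<delta>}"
    unfolding Collect_ball_eq
    by (intro closed_INT ballI closed_Collect_conj closed_Collect_le continuous_on_state continuous_on_const)
  ultimately have "compact (?P \<inter> {J. \<forall>p\<in>V. \<delta> \<le> state w s J p \<and> state w s J p \<le> u - \<delta>})"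
    by (rule compact_Int_closed)
  also have "?P \<inter> {J. \<forall>p\<in>V. \<delta> \<le> state w s J p \<and> state w s J p \<le> u - \<delta>} = box w s R \<delta>"
    by (auto simp: box_def PiE_def Pi_def)
  finally show ?thesis .
qed

lemma continuous_on_cost:
  assumes "\<delta> > 0"
  shows "continuous_on (box w s R \<delta>) (cost w s)"
proof -
  have comp: "continuous_on (box w s R \<delta>) (\<lambda>J. f (state w s J p))"
    if "p \<in> V" "\<And>x. 0 < x \<Longrightarrow> x < u \<Longrightarrow> (f has_real_derivative f' x) (at x)" for f f' p
  proof (rule continuous_on_compose2[of "{0<..<u}" f _ "\<lambda>J. state w s J p"])
    show "continuous_on {0<..<u} f"
      using that(2) by (intro DERIV_continuous_on[where D = f']) (auto intro: has_field_derivative_at_within)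
    show "(\<lambda>J. state w s J p) ` box w s R \<delta> \<subseteq> {0<..<u}"
      using assms that(1) by (force simp: box_def)
  qed (rule continuous_on_state)
  have "continuous_on (box w s R \<delta>) (\<lambda>J. S (state w s J p))"
    "continuous_on (box w s R \<delta>) (\<lambda>J. \<kappa> (state w s J p))" if "p \<in> V" for p
    using comp[OF that S_deriv] comp[OF that \<kappa>_deriv] by blast+
  then show ?thesis
    unfolding cost_def [abs_def] energy_def pair_energy_def
    by (intro continuous_on_add continuous_on_diff continuous_on_mult continuous_on_sum continuous_on_power
        continuous_on_divide continuous_on_const continuous_on_state continuous_on_coordinate) simp_all
qed

text \<open>Moving along \<theta> for small positive times stays in the box: the flux bounds are
  strict, and where a state constraint is active the divergence points inwards. The one-sided
  derivative of the cost is \<open>s\<close> times the claimed expression.\<close>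

lemma first_order_condition:
  assumes "s > 0" "0 < \<delta>" "\<delta> < u - \<delta>" and J: "J \<in> box w s R \<delta>"
    and min: "\<And>K. K \<in> box w s R \<delta> \<Longrightarrow> cost w s J \<le> cost w s K"
    and R: "\<And>e. e \<in> edges \<Longrightarrow> \<bar>J e\<bar> < R"
    and \<theta>: "\<And>e. e \<notin> edges \<Longrightarrow> \<theta> e = 0"
    and lo: "\<And>p. p \<in> V \<Longrightarrow> state w s J p = \<delta> \<Longrightarrow> dvg \<theta> p \<ge> 0"
    and hi: "\<And>p. p \<in> V \<Longrightarrow> state w s J p = u - \<delta> \<Longrightarrow> dvg \<theta> p \<le> 0"
  shows "0 \<le> 2 * (\<Sum>p\<in>V. \<Sum>q\<in>V. c p q * (J (p, q) * \<theta> (p, q))) + (\<Sum>p\<in>V. \<mu> (state w s J) p * dvg \<theta> p)"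
    (is "0 \<le> ?D")
proof -
  let ?K = "\<lambda>t e. J e + t * \<theta> e"
  have state: "state w s (?K t) p = state w s J p + t * (s * dvg \<theta> p)" for t p
    by (simp add: state_def dvg_add dvg_scale algebra_simps)
  have in_box: "0 < state w s J p" "state w s J p < u" "state w s J p \<in> {\<delta>..u - \<delta>}" if "p \<in> V" for p
    using J that assms(2) by (force simp: box_def)+
  have sq: "((\<lambda>t. s * (\<Sum>p\<in>V. \<Sum>q\<in>V. c p q * (?K t (p, q))\<^sup>2)) has_real_derivative
      s * (\<Sum>p\<in>V. \<Sum>q\<in>V. c p q * (2 * (J (p, q) * \<theta> (p, q))))) (at 0)"
    by (intro DERIV_cmult DERIV_sum) (auto intro!: derivative_eq_intros)
  have en: "((\<lambda>t. energy (state w s (?K t))) has_real_derivative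
      (\<Sum>p\<in>V. \<mu> (state w s J) p * (s * dvg \<theta> p))) (at 0)"
    unfolding state[abs_def] by (intro energy_deriv) (use in_box in auto)
  have "((\<lambda>t. cost w s (?K t)) has_real_derivative s * ?D) (at 0)"
    unfolding cost_def
    by (rule DERIV_cong[OF DERIV_add[OF sq en]]) (simp add: sum_distrib_left algebra_simps)
  moreover have "eventually (\<lambda>t. cost w s (?K 0) \<le> cost w s (?K t)) (at_right 0)"
  proof -
    have "eventually (\<lambda>t. \<forall>e\<in>edges. ?K t e \<in> {-R..R}) (at_right 0)"
    proof (intro eventually_ball_finite finite_edges ballI)
      fix e assume "e \<in> edges"
      from R[OF this] show "eventually (\<lambda>t. ?K t e \<in> {-R..R}) (at_right 0)"
        by (intro eventually_in_interval) auto
    qed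
    moreover have "eventually (\<lambda>t. \<forall>p\<in>V. state w s (?K t) p \<in> {\<delta>..u - \<delta>}) (at_right 0)"
      using finite_V unfolding state
    proof (intro eventually_ball_finite ballI)
      fix p assume "p \<in> V"
      then show "eventually (\<lambda>t. state w s J p + t * (s * dvg \<theta> p) \<in> {\<delta>..u - \<delta>}) (at_right 0)"
        using assms(1,3) in_box lo hi by (intro eventually_in_interval) (auto simp: mult_le_0_iff)
    qed
    ultimately have "eventually (\<lambda>t. ?K t \<in> box w s R \<delta>) (at_right 0)"
      by eventually_elim (use J \<theta> in \<open>auto simp: box_def split: if_splits\<close>)
    then show ?thesis by eventually_elim (use min in simp)
  qed
  ultimately have "s * ?D \<ge> 0" by (intro DERIV_nonneg_right_min)
  then show ?thesis using assms(1) by (simp add: zero_le_mult_iff)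
qed

section \<open>Bounds at extremal points\<close>

text \<open>At a minimum point all differences \<open>\<phi> q - \<phi> p\<close> are nonnegative,
  so the \<open>\<kappa>\<close> term has the favourable sign however large it is. What remains is
  bounded by monotonicity of \<open>d\<kappa>\<close>, uniformly in how close
  \<open>\<phi> p\<close> is to 0.\<close>

lemma interaction_upper:
  assumes \<phi>: "\<And>q. q \<in> V \<Longrightarrow> 0 < \<phi> q \<and> \<phi> q < u" and "p \<in> V" "\<And>q. q \<in> V \<Longrightarrow> \<phi> p \<le> \<phi> q"
    and a: "\<phi> p \<le> a" "a < u"
  shows "(\<Sum>q\<in>V. c p q * d_pair_energy (\<phi> p) (\<phi> q)) \<le> (\<Sum>p\<in>V. \<Sum>q\<in>V. c p q) * (\<bar>d\<kappa> a\<bar> * u\<^sup>2)"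
proof -
  have "d_pair_energy (\<phi> p) (\<phi> q) \<le> \<bar>d\<kappa> a\<bar> * u\<^sup>2" if "q \<in> V" for q
  proof -
    have "d\<kappa> (\<phi> p) / 2 \<le> \<bar>d\<kappa> a\<bar>" using d\<kappa>_mono[of "\<phi> p" a] \<phi>[of p] assms by auto
    then have "d\<kappa> (\<phi> p) / 2 * (\<phi> q - \<phi> p)\<^sup>2 \<le> \<bar>d\<kappa> a\<bar> * (\<phi> q - \<phi> p)\<^sup>2"
      by (rule mult_right_mono) simp
    also have "\<dots> \<le> \<bar>d\<kappa> a\<bar> * u\<^sup>2"
      using assms(3)[OF that] \<phi>[OF that] \<phi>[OF \<open>p \<in> V\<close>] by (intro mult_left_mono power_mono) auto
    finally have "d\<kappa> (\<phi> p) / 2 * (\<phi> q - \<phi> p)\<^sup>2 \<le> \<bar>d\<kappa> a\<bar> * u\<^sup>2" .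
    moreover have "(\<kappa> (\<phi> p) + \<kappa> (\<phi> q)) * (\<phi> q - \<phi> p) \<ge> 0"
      using assms(3)[OF that] \<phi>[OF that] \<phi>[OF \<open>p \<in> V\<close>] by (simp add: \<kappa>_nonneg)
    ultimately show ?thesis by (simp add: d_pair_energy_def)
  qed
  then have "(\<Sum>q\<in>V. c p q * d_pair_energy (\<phi> p) (\<phi> q)) \<le> (\<Sum>q\<in>V. c p q) * (\<bar>d\<kappa> a\<bar> * u\<^sup>2)"
    unfolding sum_distrib_right by (intro sum_mono mult_left_mono c_nonneg)
  also have "\<dots> \<le> (\<Sum>p\<in>V. \<Sum>q\<in>V. c p q) * (\<bar>d\<kappa> a\<bar> * u\<^sup>2)"
    using \<open>p \<in> V\<close> finite_V by (intro mult_right_mono member_le_sum[of p V]) (auto intro: sum_nonneg c_nonneg)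
  finally show ?thesis .
qed

text \<open>The mirror image at a maximum point, uniform in the distance of \<open>\<phi> p\<close>
  from \<open>u\<close>.\<close>

lemma interaction_lower:
  assumes \<phi>: "\<And>q. q \<in> V \<Longrightarrow> 0 < \<phi> q \<and> \<phi> q < u" and "p \<in> V" "\<And>q. q \<in> V \<Longrightarrow> \<phi> q \<le> \<phi> p"
    and a: "a \<le> \<phi> p" "0 < a"
  shows "(\<Sum>q\<in>V. c p q * d_pair_energy (\<phi> p) (\<phi> q)) \<ge> - ((\<Sum>p\<in>V. \<Sum>q\<in>V. c p q) * (\<bar>d\<kappa> a\<bar> * u\<^sup>2))"
proof -
  have "- d_pair_energy (\<phi> p) (\<phi> q) \<le> \<bar>d\<kappa> a\<bar> * u\<^sup>2" if "q \<in> V" for q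
  proof -
    have "- d\<kappa> (\<phi> p) / 2 \<le> \<bar>d\<kappa> a\<bar>" using d\<kappa>_mono[of a "\<phi> p"] \<phi>[of p] assms by auto
    then have "- d\<kappa> (\<phi> p) / 2 * (\<phi> q - \<phi> p)\<^sup>2 \<le> \<bar>d\<kappa> a\<bar> * (\<phi> q - \<phi> p)\<^sup>2"
      by (rule mult_right_mono) simp
    also have "\<dots> = \<bar>d\<kappa> a\<bar> * (\<phi> p - \<phi> q)\<^sup>2" by (simp add: power2_commute)
    also have "\<dots> \<le> \<bar>d\<kappa> a\<bar> * u\<^sup>2"
      using assms(3)[OF that] \<phi>[OF that] \<phi>[OF \<open>p \<in> V\<close>] by (intro mult_left_mono power_mono) auto
    finally have "- d\<kappa> (\<phi> p) / 2 * (\<phi> q - \<phi> p)\<^sup>2 \<le> \<bar>d\<kappa> a\<bar> * u\<^sup>2" .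
    moreover have "(\<kappa> (\<phi> p) + \<kappa> (\<phi> q)) * (\<phi> q - \<phi> p) \<le> 0"
      using assms(3)[OF that] \<phi>[OF that] \<phi>[OF \<open>p \<in> V\<close>] by (intro mult_nonneg_nonpos) (auto simp: \<kappa>_nonneg)
    ultimately show ?thesis by (simp add: d_pair_energy_def)
  qed
  then have "(\<Sum>q\<in>V. c p q * - d_pair_energy (\<phi> p) (\<phi> q)) \<le> (\<Sum>q\<in>V. c p q) * (\<bar>d\<kappa> a\<bar> * u\<^sup>2)"
    unfolding sum_distrib_right by (intro sum_mono mult_left_mono c_nonneg)
  also have "\<dots> \<le> (\<Sum>p\<in>V. \<Sum>q\<in>V. c p q) * (\<bar>d\<kappa> a\<bar> * u\<^sup>2)"
    using \<open>p \<in> V\<close> finite_V by (intro mult_right_mono member_le_sum[of p V]) (auto intro: sum_nonneg c_nonneg)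
  finally show ?thesis by (simp add: sum_negf)
qed

section \<open>From a minimiser to a solution\<close>

text \<open>When no constraint is active, a perturbation on a single edge is feasible with both
  signs, so the first-order inequality becomes \<open>2 * J (y, z) = \<mu> z - \<mu> y\<close> for
  the potential of the state. Subtracting the value on the reversed edge gives the full potential
  difference, so \<open>dvg J\<close> is its Laplacian.\<close>

lemma critical_flux:
  assumes "s > 0" "0 < \<delta>" "\<delta> < u - \<delta>" "J \<in> box w s R \<delta>"
    and "\<And>K. K \<in> box w s R \<delta> \<Longrightarrow> cost w s J \<le> cost w s K"
    and "\<And>e. e \<in> edges \<Longrightarrow> \<bar>J e\<bar> < R"
    and interior: "\<And>p. p \<in> V \<Longrightarrow> \<delta> < state w s J p \<and> state w s J p < u - \<delta>"
    and p: "p \<in> V"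
  shows "state w s J p = w p + s * lap (\<mu> (state w s J)) p"
proof -
  let ?m = "\<mu> (state w s J)"
  have J: "2 * J (y, z) = ?m z - ?m y" if e: "(y, z) \<in> edges" for y z
  proof -
    have yz: "y \<in> V" "z \<in> V" "c y z > 0" using e by (auto simp: edges_def)
    have foc: "0 \<le> 2 * (\<Sum>p\<in>V. \<Sum>q\<in>V. c p q * (J (p, q) * (t * edge_flux y z (p, q))))
        + (\<Sum>p\<in>V. ?m p * dvg (\<lambda>e. t * edge_flux y z e) p)" for t
      using interior e by (intro first_order_condition[OF assms(1-6)]) (auto simp: edge_flux_off_edges less_le)
    have "(\<Sum>p\<in>V. \<Sum>q\<in>V. c p q * (J (p, q) * (t * edge_flux y z (p, q)))) = t * J (y, z)" for t
    proof -
      have "(\<Sum>p\<in>V. \<Sum>q\<in>V. c p q * (J (p, q) * (t * edge_flux y z (p, q)))) =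
        (\<Sum>p\<in>V. \<Sum>q\<in>V. if q = z then if p = y then t * J (y, z) else 0 else 0)"
        using yz(3) by (intro sum.cong refl) (auto simp: edge_flux_def)
      then show ?thesis using yz finite_V by simp
    qed
    moreover have "(\<Sum>p\<in>V. ?m p * dvg (\<lambda>e. t * edge_flux y z e) p) = t * (?m y - ?m z)" for t
    proof -
      have "(\<Sum>p\<in>V. ?m p * dvg (\<lambda>e. t * edge_flux y z e) p) =
        (\<Sum>p\<in>V. (if p = y then t * ?m y else 0) - (if p = z then t * ?m z else 0))"
        using e by (intro sum.cong refl) (auto simp: dvg_scale dvg_edge_flux)
      then show ?thesis using yz finite_V by (simp add: sum_subtractf algebra_simps)
    qed
    ultimately have "0 \<le> 2 * (t * J (y, z)) + t * (?m y - ?m z)" for t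
      using foc[of t] by (simp only:)
    from this[of 1] this[of "-1"] show ?thesis by simp
  qed
  have "dvg J p = lap ?m p"
    unfolding dvg_def lap_def
  proof (intro sum.cong refl)
    fix q assume "q \<in> V"
    show "c p q * (J (p, q) - J (q, p)) = c p q * (?m q - ?m p)"
    proof (cases "c p q = 0")
      case False
      then have "(p, q) \<in> edges" "(q, p) \<in> edges"
        using p \<open>q \<in> V\<close> c_nonneg[of p q] c_sym[of p q] by (auto simp: edges_def less_le)
      from J[OF this(1)] J[OF this(2)] show ?thesis by simp
    qed simp
  qed
  then show ?thesis by (simp add: state_def)
qed

lemma ex_margin:
  assumes "0 < a" "a < u"
  shows "\<exists>\<delta>>0. \<delta> < a \<and> a < u - \<delta> \<and> dS \<delta> < lo \<and> hi < dS (u - \<delta>)"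
proof -
  have 1: "eventually (\<lambda>\<delta>. dS \<delta> < lo) (at_right 0)"
    using dS_at_0 by (auto simp: filterlim_at_bot_dense)
  have "filterlim (\<lambda>\<delta>. u - \<delta>) (at_left u) (at_right 0)"
    by (rule filterlim_at_withinI) 
       (auto intro!: tendsto_eq_intros simp: eventually_at_right_less)
  then have "filterlim (\<lambda>\<delta>. dS (u - \<delta>)) at_top (at_right 0)"
    by (rule filterlim_compose[OF dS_at_u])
  then have 2: "eventually (\<lambda>\<delta>. hi < dS (u - \<delta>)) (at_right 0)"
    by (auto simp: filterlim_at_top_dense)
  have 3: "eventually (\<lambda>\<delta>. \<delta> < min a (u - a)) (at_right 0)"
    using assms by (intro order_tendstoD(2)[OF tendsto_ident_at]) auto
  have "eventually (\<lambda>\<delta>. \<delta> > 0 \<and> \<delta> < a \<and> a < u - \<delta> \<and> dS \<delta> < lo \<and> hi < dS (u - \<delta>)) (at_right 0)"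
    using 1 2 3 eventually_at_right_less[of "0::real"] by eventually_elim auto
  then show ?thesis using eventually_happens by fastforce
qed

text \<open>The order of choices matters: the competitor \<open>J0\<close>, the flux bound
  \<open>R\<close> and the constant \<open>D\<close> are fixed first, and only then the margin
  \<delta>.\<close>

lemma ex_solution:
  assumes "s > 0" and w: "0 < (\<Sum>p\<in>V. w p)" "(\<Sum>p\<in>V. w p) < real (card V) * u"
  shows "\<exists>\<phi>. (\<forall>p\<in>V. 0 < \<phi> p \<and> \<phi> p < u) \<and> (\<forall>p\<in>V. \<phi> p = w p + s * lap (\<mu> \<phi>) p)"
proof -
  have card: "real (card V) > 0" using finite_V V_nonempty by (simp add: card_gt_0_iff)
  define a where "a = (\<Sum>p\<in>V. w p) / real (card V)"
  have a: "0 < a" "a < u" using w card by (auto simp: a_def field_simps)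
  \<comment> \<open>The flux \<open>J0\<close> levels \<open>w\<close> to its mean \<open>a\<close>,
    a competitor whose state is feasible for every margin below \<open>a\<close> and
    \<open>u - a\<close>.\<close>
  have "(\<Sum>p\<in>V. a - w p) = 0" using card by (simp add: sum_subtractf a_def)
  then have "(\<Sum>p\<in>V. (a - w p) / s) = 0"
    by (simp only: sum_divide_distrib[symmetric] div_0)
  from ex_flux[OF this] obtain J0
    where J0: "\<And>e. e \<notin> edges \<Longrightarrow> J0 e = 0" "\<And>p. p \<in> V \<Longrightarrow> dvg J0 p = (a - w p) / s"
    by blast
  have state_J0: "state w s J0 p = a" if "p \<in> V" for p
    using that assms(1) by (simp add: state_def J0(2))
  obtain L where L: "\<And>\<phi>. (\<forall>p\<in>V. 0 < \<phi> p \<and> \<phi> p < u) \<Longrightarrow> L \<le> energy \<phi>"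
    using energy_bounded_below by blast
  \<comment> \<open>\<open>Q\<close> bounds the kinetic sum of any feasible flux no costlier than
    \<open>J0\<close>, and \<open>C\<close> dominates every \<open>1 / c p q\<close> on edges. The
    added 1 in \<open>R\<close> turns the bound \<open>R - 1\<close> on the square of the flux into
    a strict bound \<open>R\<close> on its modulus.\<close>
  define C where "C = (\<Sum>(p, q)\<in>edges. 1 / c p q)"
  define Q where "Q = (cost w s J0 - L) / s"
  define R where "R = Q * C + 1"
  have flux_bound: "\<bar>J e\<bar> < R"
    if J: "cost w s J \<le> cost w s J0" "\<And>p. p \<in> V \<Longrightarrow> 0 < state w s J p \<and> state w s J p < u" and "e \<in> edges" for J e
  proof -
    obtain p q where e: "e = (p, q)" "p \<in> V" "q \<in> V" "c p q > 0" using \<open>e \<in> edges\<close> by (auto simp: edges_def)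
    have "c p q * (J e)\<^sup>2 \<le> (\<Sum>q\<in>V. c p q * (J (p, q))\<^sup>2)"
      unfolding e(1) using e finite_V c_nonneg by (intro member_le_sum[of q V "\<lambda>q. c p q * (J (p, q))\<^sup>2"]) auto
    also have "\<dots> \<le> (\<Sum>p\<in>V. \<Sum>q\<in>V. c p q * (J (p, q))\<^sup>2)"
      using e finite_V c_nonneg
      by (intro member_le_sum[of p V "\<lambda>p. \<Sum>q\<in>V. c p q * (J (p, q))\<^sup>2"]) (auto intro!: sum_nonneg)
    also have "\<dots> \<le> Q"
      using J(1) L[of "state w s J"] J(2) assms(1) by (auto simp: cost_def Q_def field_simps)
    finally have le: "c p q * (J e)\<^sup>2 \<le> Q" .
    moreover have "0 \<le> c p q * (J e)\<^sup>2" using e(4) by simp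
    ultimately have nonneg: "0 \<le> Q" by linarith
    have "(J e)\<^sup>2 \<le> Q * (1 / c p q)" using le e(4) by (simp add: field_simps)
    also have "\<dots> \<le> Q * C"
    proof (rule mult_left_mono[OF _ nonneg])
      have "(case e of (p, q) \<Rightarrow> 1 / c p q) \<le> C"
        unfolding C_def using \<open>e \<in> edges\<close> finite_edges c_nonneg by (intro member_le_sum) auto
      then show "1 / c p q \<le> C" using e(1) by simp
    qed
    finally have sq: "(J e)\<^sup>2 \<le> R - 1" by (simp add: R_def)
    show ?thesis
    proof (rule ccontr)
      assume "\<not> \<bar>J e\<bar> < R"
      moreover have "R \<ge> 1" using sq zero_le_power2[of "J e"] by linarith
      ultimately have "R * 1 \<le> \<bar>J e\<bar> * \<bar>J e\<bar>" by (intro mult_mono) auto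
      then show False using sq by (simp add: power2_eq_square)
    qed
  qed
  have "\<forall>p q. \<exists>J. p \<in> V \<and> q \<in> V \<longrightarrow>
      (\<forall>e. e \<notin> edges \<longrightarrow> J e = 0) \<and> (\<forall>x\<in>V. dvg J x = of_bool (x = p) - of_bool (x = q))"
    using ex_path_flux by blast
  then obtain T where T: "\<And>p q e. p \<in> V \<Longrightarrow> q \<in> V \<Longrightarrow> e \<notin> edges \<Longrightarrow> T p q e = 0"
    "\<And>p q x. p \<in> V \<Longrightarrow> q \<in> V \<Longrightarrow> x \<in> V \<Longrightarrow> dvg (T p q) x = of_bool (x = p) - of_bool (x = q)"
    by metis
  \<comment> \<open>All pairs of endpoints are summed because the extremal points of the minimiser
    depend on \<delta>, while \<open>B\<close> has to be fixed before it.\<close>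
  define B where "B = (\<Sum>x\<in>V. \<Sum>y\<in>V. \<Sum>p\<in>V. \<Sum>q\<in>V. c p q * (R * \<bar>T x y (p, q)\<bar>))"
  define G where "G = (\<Sum>p\<in>V. \<Sum>q\<in>V. c p q) * (\<bar>d\<kappa> a\<bar> * u\<^sup>2)"
  define A where "A = (\<Sum>p\<in>V. \<bar>H p\<bar>)"
  \<comment> \<open>\<open>2 * B\<close> comes from the kinetic term; \<open>G\<close> and
    \<open>A\<close> occur twice, once for each extremal point.\<close>
  define D where "D = 2 * B + 2 * G + 2 * A"
  obtain \<delta> where \<delta>: "\<delta> > 0" "\<delta> < a" "a < u - \<delta>" "dS \<delta> < dS a - D" "dS a + D < dS (u - \<delta>)"
    using ex_margin[OF a] by metis
  have "\<bar>J0 e\<bar> < R" if "e \<in> edges" for e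
    using that a by (intro flux_bound) (auto simp: state_J0)
  then have "J0 \<in> box w s R \<delta>"
    using \<delta> J0(1) by (auto simp: box_def state_J0 abs_less_iff less_imp_le)
       (metis less_imp_le minus_le_iff)
  then obtain J where J: "J \<in> box w s R \<delta>" "\<And>K. K \<in> box w s R \<delta> \<Longrightarrow> cost w s J \<le> cost w s K"
    using continuous_attains_inf[OF compact_box _ continuous_on_cost[OF \<delta>(1)]] by (metis empty_iff)
  define \<phi> where "\<phi> = state w s J"
  have \<phi>: "\<delta> \<le> \<phi> p" "\<phi> p \<le> u - \<delta>" "0 < \<phi> p \<and> \<phi> p < u" if "p \<in> V" for p
    using J(1) \<delta>(1) that by (force simp: box_def \<phi>_def)+
  have JR: "\<bar>J e\<bar> < R" if "e \<in> edges" for e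
    using that J(2)[OF \<open>J0 \<in> box w s R \<delta>\<close>] \<phi>(3) unfolding \<phi>_def by (intro flux_bound) auto
  have "\<delta> < u - \<delta>" using \<delta> by linarith
  obtain p where p: "p \<in> V" "\<And>x. x \<in> V \<Longrightarrow> \<phi> p \<le> \<phi> x"
    using finite_V V_nonempty by (metis arg_min_if_finite(1) arg_min_least)
  obtain q where q: "q \<in> V" "\<And>x. x \<in> V \<Longrightarrow> \<phi> x \<le> \<phi> q"
    using finite_V V_nonempty obtains_MAX[of V \<phi>] by (metis Max_ge finite_imageI imageI)
  have mean: "(\<Sum>x\<in>V. \<phi> x) = real (card V) * a"
  proof -
    have "(\<Sum>x\<in>V. \<phi> x) = (\<Sum>x\<in>V. w x) + s * (\<Sum>x\<in>V. dvg J x)"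
      by (simp add: \<phi>_def state_def sum.distrib sum_distrib_left)
    then show ?thesis using card by (simp add: sum_dvg a_def)
  qed
  have "\<phi> p \<le> a"
    using sum_mono[of V "\<lambda>_. \<phi> p" \<phi>] p(2) mean card by simp
  have "a \<le> \<phi> q"
    using sum_mono[of V \<phi> "\<lambda>_. \<phi> q"] q(2) mean card by simp
  \<comment> \<open>\<open>T p q\<close> takes mass from the maximum point \<open>q\<close> to the
    minimum point \<open>p\<close>. This is feasible because \<open>\<phi> q\<close> is at least
    \<open>a\<close>, hence above \<delta>, and \<open>\<phi> p\<close> is at most \<open>a\<close>,
    hence below \<open>u - \<delta>\<close>.\<close>
  have "0 \<le> 2 * (\<Sum>x\<in>V. \<Sum>y\<in>V. c x y * (J (x, y) * T p q (x, y))) + (\<Sum>x\<in>V. \<mu> \<phi> x * dvg (T p q) x)"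
    unfolding \<phi>_def
  proof (rule first_order_condition[OF \<open>s > 0\<close> \<delta>(1) \<open>\<delta> < u - \<delta>\<close> J JR T(1)[OF p(1) q(1)]])
    fix x assume "x \<in> V" "state w s J x = \<delta>"
    then show "dvg (T p q) x \<ge> 0" using \<open>a \<le> \<phi> q\<close> \<delta>(2) T(2)[OF p(1) q(1), of x] by (auto simp: \<phi>_def)
  next
    fix x assume "x \<in> V" "state w s J x = u - \<delta>"
    then show "dvg (T p q) x \<le> 0" using \<open>\<phi> p \<le> a\<close> \<delta>(3) T(2)[OF p(1) q(1), of x] by (auto simp: \<phi>_def)
  qed
  also have "(\<Sum>x\<in>V. \<mu> \<phi> x * dvg (T p q) x) = (\<Sum>x\<in>V. (if x = p then \<mu> \<phi> p else 0) - (if x = q then \<mu> \<phi> q else 0))"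
    by (intro sum.cong refl) (auto simp: T(2)[OF p(1) q(1)])
  also have "\<dots> = \<mu> \<phi> p - \<mu> \<phi> q" using p(1) q(1) finite_V by (simp add: sum_subtractf)
  also have "(\<Sum>x\<in>V. \<Sum>y\<in>V. c x y * (J (x, y) * T p q (x, y))) \<le> B"
  proof -
    have JT: "J e * T p q e \<le> R * \<bar>T p q e\<bar>" for e
    proof (cases "e \<in> edges")
      case True
      have "J e * T p q e \<le> \<bar>J e\<bar> * \<bar>T p q e\<bar>" by (simp add: abs_mult[symmetric])
      also have "\<dots> \<le> R * \<bar>T p q e\<bar>" using JR[OF True] by (intro mult_right_mono) auto
      finally show ?thesis .
    qed (simp add: T(1)[OF p(1) q(1)])
    \<comment> \<open>The sign of \<open>R\<close> is read off on an edge, where it exceeds a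
      modulus; off the edges the path fluxes vanish.\<close>
    have Rc: "0 \<le> c x y * (R * \<bar>T p' q' (x, y)\<bar>)" if "p' \<in> V" "q' \<in> V" for p' q' x y
    proof (cases "(x, y) \<in> edges")
      case True
      then show ?thesis using JR[OF True] by (intro mult_nonneg_nonneg c_nonneg) auto
    qed (simp add: T(1)[OF that])
    have "(\<Sum>x\<in>V. \<Sum>y\<in>V. c x y * (J (x, y) * T p q (x, y))) \<le> (\<Sum>x\<in>V. \<Sum>y\<in>V. c x y * (R * \<bar>T p q (x, y)\<bar>))"
      by (intro sum_mono mult_left_mono c_nonneg JT)
    also have "\<dots> \<le> (\<Sum>q'\<in>V. \<Sum>x\<in>V. \<Sum>y\<in>V. c x y * (R * \<bar>T p q' (x, y)\<bar>))"
      using q(1) p(1) finite_V Rc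
      by (intro member_le_sum[of q V "\<lambda>q'. \<Sum>x\<in>V. \<Sum>y\<in>V. c x y * (R * \<bar>T p q' (x, y)\<bar>)"]) (auto intro!: sum_nonneg)
    also have "\<dots> \<le> B"
      unfolding B_def using p(1) finite_V Rc
      by (intro member_le_sum[of p V "\<lambda>p'. \<Sum>q'\<in>V. \<Sum>x\<in>V. \<Sum>y\<in>V. c x y * (R * \<bar>T p' q' (x, y)\<bar>)"]) (auto intro!: sum_nonneg)
    finally show ?thesis .
  qed
  finally have "\<mu> \<phi> q - \<mu> \<phi> p \<le> 2 * B" by simp
  moreover have "(\<Sum>x\<in>V. c p x * d_pair_energy (\<phi> p) (\<phi> x)) \<le> G"
    unfolding G_def using \<phi>(3) p \<open>\<phi> p \<le> a\<close> a(2) by (intro interaction_upper) auto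
  moreover have "(\<Sum>x\<in>V. c q x * d_pair_energy (\<phi> q) (\<phi> x)) \<ge> - G"
    unfolding G_def using \<phi>(3) q \<open>a \<le> \<phi> q\<close> a(1) by (intro interaction_lower) auto
  moreover have "\<bar>H p\<bar> \<le> A" "\<bar>H q\<bar> \<le> A"
    unfolding A_def using p(1) q(1) finite_V by (intro member_le_sum; simp)+
  ultimately have "dS (\<phi> q) - dS (\<phi> p) \<le> D"
    unfolding \<mu>_def D_def by linarith
  \<comment> \<open>\<open>dS a\<close> lies between the two extremal values, so each of them is
    within \<open>D\<close> of it, and the choice of \<delta> excludes the endpoints.\<close>
  moreover have "dS a \<le> dS (\<phi> q)" "dS (\<phi> p) \<le> dS a"
    using \<open>\<phi> p \<le> a\<close> \<open>a \<le> \<phi> q\<close> \<phi>(3) p(1) q(1) a by (auto intro!: dS_mono)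
  ultimately have "dS \<delta> < dS (\<phi> p)" "dS (\<phi> q) < dS (u - \<delta>)" using \<delta>(4,5) by linarith+
  then have "\<delta> < \<phi> p" "\<phi> q < u - \<delta>"
    using \<phi>[OF p(1)] \<phi>[OF q(1)] by (auto simp: less_le)
  then have "\<delta> < \<phi> x \<and> \<phi> x < u - \<delta>" if "x \<in> V" for x
    using p(2)[OF that] q(2)[OF that] by linarith
  then have "\<phi> x = w x + s * lap (\<mu> \<phi>) x" if "x \<in> V" for x
    unfolding \<phi>_def using that
    by (intro critical_flux[OF \<open>s > 0\<close> \<delta>(1) \<open>\<delta> < u - \<delta>\<close> J JR]) (auto simp: \<phi>_def)
  then show ?thesis using \<phi>(3) by blast
qed

end

subsection \<open>The constitutive functions\<close>

text \<open>Write \<open>kappa\<close> as 1/f with f a concave quadratic. Then z^2/f is the maximum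
  over t of 2tz - t^2 f; the value of t optimal at \<open>(a, z)\<close> yields the tangent plane
  once f is replaced by its tangent, which lies above it by
  \<open>36 * (a' - a)\<^sup>2\<close>.\<close>

lemma kappa_perspective:
  assumes "0 < a" "a < 1" "0 < a'" "a' < 1"
  shows "kappa a' * z'\<^sup>2 \<ge> kappa a * z\<^sup>2 + dkappa a * z\<^sup>2 * (a' - a) + 2 * kappa a * z * (z' - z)"
proof -
  define f where "f x = 36 * x * (1 - x)" for x :: real
  have f: "f a > 0" "f a' > 0" using assms by (simp_all add: f_def)
  have k: "kappa a = 1 / f a" "kappa a' = 1 / f a'" "dkappa a = - (36 * (1 - 2 * a)) / (f a)\<^sup>2"
    using assms by (simp_all add: kappa_def dkappa_def f_def power_mult_distrib) (simp add: field_simps)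
  define t where "t = z / f a"
  have t: "kappa a * z = t" "kappa a * z\<^sup>2 = t\<^sup>2 * f a" "dkappa a * z\<^sup>2 = - t\<^sup>2 * (36 * (1 - 2 * a))" "z = t * f a"
    using f by (simp_all add: t_def k power2_eq_square) (simp add: field_simps)
  have "kappa a * z\<^sup>2 + dkappa a * z\<^sup>2 * (a' - a) + 2 * kappa a * z * (z' - z) =
    2 * t * z' - t\<^sup>2 * (f a + 36 * (1 - 2 * a) * (a' - a))"
  proof -
    have "2 * kappa a * z * (z' - z) = 2 * (kappa a * z) * (z' - z)" by simp
    also have "\<dots> = 2 * t * (z' - t * f a)" by (simp only: t(1)) (simp only: t(4))
    finally show ?thesis unfolding t(2,3) by (simp add: power2_eq_square algebra_simps)
  qed
  also have "f a + 36 * (1 - 2 * a) * (a' - a) = f a' + 36 * (a' - a)\<^sup>2"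
    by (simp add: f_def power2_eq_square algebra_simps)
  also have "2 * t * z' - t\<^sup>2 * (f a' + 36 * (a' - a)\<^sup>2) \<le> 2 * t * z' - t\<^sup>2 * f a'"
    by (simp add: mult_left_mono)
  also have "\<dots> \<le> kappa a' * z'\<^sup>2"
  proof -
    have "0 \<le> (z' - t * f a')\<^sup>2" by simp
    also have "\<dots> = z'\<^sup>2 - (2 * t * z' - t\<^sup>2 * f a') * f a'"
      by (simp add: power2_eq_square algebra_simps)
    finally show ?thesis using f by (simp add: k field_simps)
  qed
  finally show ?thesis .
qed

lemma dS_less:
  assumes "M > 0" "N > 0" "0 < x" "x < y" "y < 1 / rho M N"
  shows "dS M N x < dS M N y"
proof -
  have r: "rho M N > 0" using rho_gt_1[OF assms(1,2)] by simp
  have "rho M N * x < rho M N * y" "rho M N * y < 1" using r assms by (auto simp: field_simps)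
  then have "ln (1 - rho M N * y) < ln (1 - rho M N * x)" by simp
  then have "rho M N * ln (1 - rho M N * y) < rho M N * ln (1 - rho M N * x)" using r by simp
  moreover have "(1 / tau M N + 1 / N) * ln x < (1 / tau M N + 1 / N) * ln y"
    using assms tau_pos[OF assms(1,2)] by (intro mult_strict_left_mono) (auto intro: add_pos_pos)
  ultimately show ?thesis by (simp add: dS_def)
qed

lemma dS_at_right_0:
  assumes "M > 0" "N > 0"
  shows "filterlim (dS M N) at_bot (at_right 0)"
proof -
  have A: "1 / tau M N + 1 / N > 0" using assms tau_pos[OF assms] by (auto intro: add_pos_pos)
  have "((\<lambda>x. rho M N * ln (1 - rho M N * x)) \<longlongrightarrow> 0) (at_right 0)"
    by (auto intro!: tendsto_eq_intros)
  moreover have "filterlim (\<lambda>x. (1 / tau M N + 1 / N) * ln x) at_bot (at_right 0)"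
    by (rule filterlim_tendsto_pos_mult_at_bot[OF tendsto_const A ln_at_0])
  then have "filterlim (\<lambda>x. - ((1 / tau M N + 1 / N) * ln x)) at_top (at_right 0)"
    by (simp only: filterlim_uminus_at_bot)
  ultimately have "filterlim (\<lambda>x. rho M N * ln (1 - rho M N * x) + - ((1 / tau M N + 1 / N) * ln x)) at_top (at_right 0)"
    by (rule filterlim_tendsto_add_at_top)
  then have "filterlim (\<lambda>x. - dS M N x) at_top (at_right 0)"
    by (simp add: dS_def)
  then show ?thesis by (simp only: filterlim_uminus_at_bot)
qed

lemma dS_at_left_max:
  assumes "M > 0" "N > 0"
  shows "filterlim (dS M N) at_top (at_left (1 / rho M N))"
proof -
  have r: "rho M N > 0" using rho_gt_1[OF assms] by simp
  have "filterlim (\<lambda>x. 1 - rho M N * x) (at_right 0) (at_left (1 / rho M N))"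
    using r by (intro filterlim_at_withinI)
      (auto intro!: tendsto_eq_intros simp: eventually_at_filter field_simps)
  then have "filterlim (\<lambda>x. ln (1 - rho M N * x)) at_bot (at_left (1 / rho M N))"
    by (rule filterlim_compose[OF ln_at_0])
  then have "filterlim (\<lambda>x. rho M N * ln (1 - rho M N * x)) at_bot (at_left (1 / rho M N))"
    by (rule filterlim_tendsto_pos_mult_at_bot[OF tendsto_const r])
  then have "filterlim (\<lambda>x. - (rho M N * ln (1 - rho M N * x))) at_top (at_left (1 / rho M N))"
    by (simp add: filterlim_uminus_at_top)
  moreover have "((\<lambda>x. (1 / tau M N + 1 / N) * ln x) \<longlongrightarrow> (1 / tau M N + 1 / N) * ln (1 / rho M N)) (at_left (1 / rho M N))"
    using r by (auto intro!: tendsto_eq_intros)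
  ultimately have "filterlim (\<lambda>x. (1 / tau M N + 1 / N) * ln x + - (rho M N * ln (1 - rho M N * x))) at_top (at_left (1 / rho M N))"
    by (intro filterlim_tendsto_add_at_top)
  then show ?thesis by (simp add: dS_def[abs_def])
qed

subsection \<open>The periodic grid as a weighted graph\<close>

text \<open>Cyclic neighbours inside \<open>cells\<close>, replacing the ghost cells filled by
  \<open>periodic_ext\<close>. Indices of cells start at 1, so the subtractions in
  \<open>west\<close> and \<open>south\<close> are exact there.\<close>

definition east :: "nat \<Rightarrow> nat \<times> nat \<Rightarrow> nat \<times> nat" where
  "east m = (\<lambda>(i, j). (wrap m (i + 1), j))"

definition west :: "nat \<Rightarrow> nat \<times> nat \<Rightarrow> nat \<times> nat" where
  "west m = (\<lambda>(i, j). (wrap m (i - 1), j))"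

definition north :: "nat \<Rightarrow> nat \<times> nat \<Rightarrow> nat \<times> nat" where
  "north n = (\<lambda>(i, j). (i, wrap n (j + 1)))"

definition south :: "nat \<Rightarrow> nat \<times> nat \<Rightarrow> nat \<times> nat" where
  "south n = (\<lambda>(i, j). (i, wrap n (j - 1)))"

text \<open>
  On a direction with at most two cells the two neighbours coincide and their weights add up; with a
  single cell the weight is a loop, which contributes nothing to \<open>lap\<close>.
\<close>

definition torus_weight :: "nat \<Rightarrow> nat \<Rightarrow> real \<Rightarrow> real \<Rightarrow> nat \<times> nat \<Rightarrow> nat \<times> nat \<Rightarrow> real" where
  "torus_weight m n hx hy p q = (of_bool (q = east m p) + of_bool (q = west m p)) / hx\<^sup>2
     + (of_bool (q = north n p) + of_bool (q = south n p)) / hy\<^sup>2"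

lemma neighbour_in_cells:
  assumes "p \<in> cells m n"
  shows "east m p \<in> cells m n" "west m p \<in> cells m n" "north n p \<in> cells m n" "south n p \<in> cells m n"
  using assms by (auto simp: cells_def east_def west_def north_def south_def wrap_def)

lemma neighbour_inverse:
  assumes "p \<in> cells m n"
  shows "west m (east m p) = p" "east m (west m p) = p" "south n (north n p) = p" "north n (south n p) = p"
  using assms by (auto simp: cells_def east_def west_def north_def south_def wrap_def)

text \<open>Each shift permutes the cells, its inverse being the opposite shift.\<close>

lemma sum_east_west: "(\<Sum>p\<in>cells m n. f (east m p)) = (\<Sum>p\<in>cells m n. f (west m p))"
proof -
  have "(\<Sum>p\<in>cells m n. f (east m p)) = sum f (cells m n)"
    by (intro sum.reindex_bij_betw bij_betw_byWitness[of _ "west m"]) (auto simp: neighbour_inverse neighbour_in_cells)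
  moreover have "(\<Sum>p\<in>cells m n. f (west m p)) = sum f (cells m n)"
    by (intro sum.reindex_bij_betw bij_betw_byWitness[of _ "east m"]) (auto simp: neighbour_inverse neighbour_in_cells)
  ultimately show ?thesis by simp
qed

lemma sum_north_south: "(\<Sum>p\<in>cells m n. f (north n p)) = (\<Sum>p\<in>cells m n. f (south n p))"
proof -
  have "(\<Sum>p\<in>cells m n. f (north n p)) = sum f (cells m n)"
    by (intro sum.reindex_bij_betw bij_betw_byWitness[of _ "south n"]) (auto simp: neighbour_inverse neighbour_in_cells)
  moreover have "(\<Sum>p\<in>cells m n. f (south n p)) = sum f (cells m n)"
    by (intro sum.reindex_bij_betw bij_betw_byWitness[of _ "north n"]) (auto simp: neighbour_inverse neighbour_in_cells)
  ultimately show ?thesis by simp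
qed

lemma finite_cells: "finite (cells m n)"
  by (simp add: cells_def)

lemma sum_torus_weight:
  assumes "p \<in> cells m n"
  shows "(\<Sum>q\<in>cells m n. torus_weight m n hx hy p q * f q) =
    (f (east m p) + f (west m p)) / hx\<^sup>2 + (f (north n p) + f (south n p)) / hy\<^sup>2"
proof -
  have "(\<Sum>q\<in>cells m n. torus_weight m n hx hy p q * f q) = (\<Sum>q\<in>cells m n.
      (if q = east m p then f (east m p) / hx\<^sup>2 else 0) + (if q = west m p then f (west m p) / hx\<^sup>2 else 0)
      + ((if q = north n p then f (north n p) / hy\<^sup>2 else 0) + (if q = south n p then f (south n p) / hy\<^sup>2 else 0)))"
    by (intro sum.cong refl) (auto simp: torus_weight_def add_divide_distrib distrib_right)
  then show ?thesis
    using neighbour_in_cells[OF assms] by (simp add: sum.distrib finite_cells add_divide_distrib)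
qed

text \<open>For connectedness, go from the corner \<open>(1, 1)\<close> north along the first column
  and then east along a row; symmetry joins any two cells through the corner.\<close>

lemma weighted_graph_torus:
  assumes "m > 0" "n > 0" "hx > 0" "hy > 0"
  shows "weighted_graph (cells m n) (torus_weight m n hx hy)"
proof
  show "finite (cells m n)" by (rule finite_cells)
  show "cells m n \<noteq> {}" using assms by (simp add: cells_def)
  show "0 \<le> torus_weight m n hx hy p q" for p q by (simp add: torus_weight_def)
  show sym: "torus_weight m n hx hy p q = torus_weight m n hx hy q p" if "p \<in> cells m n" "q \<in> cells m n" for p q
  proof -
    have "q = east m p \<longleftrightarrow> p = west m q" "q = west m p \<longleftrightarrow> p = east m q"
      "q = north n p \<longleftrightarrow> p = south n q" "q = south n p \<longleftrightarrow> p = north n q"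
      using neighbour_inverse[OF that(1)] neighbour_inverse[OF that(2)] by metis+
    then show ?thesis by (simp add: torus_weight_def add.commute)
  qed
  let ?R = "{(x, y). x \<in> cells m n \<and> y \<in> cells m n \<and> 0 < torus_weight m n hx hy x y}"
  have "sym ?R" using sym by (auto simp: sym_def)
  then have symR: "sym (?R\<^sup>*)" by (rule sym_rtrancl)
  have pos: "torus_weight m n hx hy p (east m p) > 0" "torus_weight m n hx hy p (north n p) > 0" for p
    using assms(3,4) by (auto simp: torus_weight_def intro!: add_pos_nonneg add_nonneg_pos)
  have row: "((1, j), (Suc i, j)) \<in> ?R\<^sup>*" if "j \<in> {1..n}" "i < m" for i j
    using that(2)
  proof (induction i)
    case (Suc i)
    have e: "east m (Suc i, j) = (Suc (Suc i), j)" using Suc.prems by (simp add: east_def wrap_def)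
    have "((Suc i, j), (Suc (Suc i), j)) \<in> ?R"
      using Suc.prems that(1) pos(1)[of "(Suc i, j)"] by (simp add: e) (simp add: cells_def)
    then show ?case using Suc by (meson Suc_lessD rtrancl.rtrancl_into_rtrancl)
  qed simp
  have column: "((1, 1), (1, Suc j)) \<in> ?R\<^sup>*" if "j < n" for j
    using that
  proof (induction j)
    case (Suc j)
    have e: "north n (Suc 0, Suc j) = (Suc 0, Suc (Suc j))" using Suc.prems by (simp add: north_def wrap_def)
    have "((1, Suc j), (1, Suc (Suc j))) \<in> ?R"
      using Suc.prems assms(1) pos(2)[of "(Suc 0, Suc j)"] by (simp add: e) (simp add: cells_def)
    then show ?case using Suc by (meson Suc_lessD rtrancl.rtrancl_into_rtrancl)
  qed simp
  have from_corner: "((1, 1), p) \<in> ?R\<^sup>*" if "p \<in> cells m n" for p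
  proof -
    obtain i j where p: "p = (Suc i, Suc j)" "i < m" "j < n"
      using \<open>p \<in> cells m n\<close> by (cases p; cases "fst p"; cases "snd p") (auto simp: cells_def)
    show ?thesis using rtrancl_trans[OF column[OF p(3)] row[of "Suc j" i]] p by simp
  qed
  show "(p, q) \<in> ?R\<^sup>*" if "p \<in> cells m n" "q \<in> cells m n" for p q
    using rtrancl_trans[OF symD[OF symR from_corner[OF that(1)]] from_corner[OF that(2)]] .
qed

section \<open>Transfer between grid functions and the graph\<close>

lemma periodic_ext_eq:
  assumes "\<phi> \<in> grid_fun m n" "periodic_grid m n \<phi>" "m > 0" "n > 0"
  shows "periodic_ext m n \<phi> = \<phi>"
proof
  fix p
  show "periodic_ext m n \<phi> p = \<phi> p"
  proof (cases "p \<in> grid m n")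
    case True
    obtain i j where p: "p = (i, j)" by (cases p)
    have ij: "i \<in> {0..m + 1}" "j \<in> {0..n + 1}" using True by (simp_all add: p grid_def)
    \<comment> \<open>The order of unwrapping matters: periodicity in x is given only for rows 1 to
      n, periodicity in y for all columns including the ghost ones.\<close>
    then have "wrap n j \<in> {1..n}" using assms(4) by (auto simp: wrap_def)
    then have "\<phi> (wrap m i, wrap n j) = \<phi> (i, wrap n j)"
      using assms(2) by (simp add: periodic_grid_def wrap_def[of m])
    also have "\<dots> = \<phi> (i, j)"
      using assms(2) ij(1) by (simp add: periodic_grid_def wrap_def)
    finally show ?thesis using True by (simp add: p periodic_ext_def)
  next
    case False
    then show ?thesis
      using PiE_arb[of \<phi> "grid m n" "\<lambda>_. UNIV" p] assms(1) by (simp add: periodic_ext_def grid_fun_def)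
  qed
qed

lemma periodic_ext_neighbour:
  assumes "(i, j) \<in> cells m n"
  shows "periodic_ext m n f (i + 1, j) = f (east m (i, j))" "periodic_ext m n f (i - 1, j) = f (west m (i, j))"
    "periodic_ext m n f (i, j + 1) = f (north n (i, j))" "periodic_ext m n f (i, j - 1) = f (south n (i, j))"
  using assms by (auto simp: periodic_ext_def cells_def grid_def wrap_def east_def west_def north_def south_def)

lemma periodic_ext_cong:
  assumes "\<And>p. p \<in> cells m n \<Longrightarrow> f p = h p" "m > 0" "n > 0"
  shows "periodic_ext m n f = periodic_ext m n h"
  using assms by (auto simp: periodic_ext_def fun_eq_iff grid_def cells_def wrap_def)

text \<open>Averaging the two adjacent edge differences leaves a centred difference, whose sum
  vanishes by shift invariance. Hence the noise carries no mass.\<close>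

lemma sum_noise: "(\<Sum>p\<in>cells m n. noise hx hy s m n r1 r2 p) = 0"
proof -
  have "noise hx hy s m n r1 r2 p = - (sqrt 2 / sqrt (hx * hy * s)) *
      ((r1 (east m p) - r1 (west m p)) / (2 * hx) + (r2 (north n p) - r2 (south n p)) / (2 * hy))"
    if "p \<in> cells m n" for p
  proof -
    obtain i j where p: "p = (i, j)" by (cases p)
    then have c: "(i, j) \<in> cells m n" "i \<ge> 1" "j \<ge> 1" using that by (auto simp: cells_def)
    show ?thesis
      unfolding p noise_def a_x_def a_y_def D_x_def D_y_def
      using c periodic_ext_neighbour[OF c(1)] by (simp add: add_divide_distrib[symmetric])
  qed
  then have "(\<Sum>p\<in>cells m n. noise hx hy s m n r1 r2 p) = - (sqrt 2 / sqrt (hx * hy * s)) *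
     (\<Sum>p\<in>cells m n. (r1 (east m p) - r1 (west m p)) / (2 * hx) + (r2 (north n p) - r2 (south n p)) / (2 * hy))"
    by (simp add: sum_distrib_left)
  also have "(\<Sum>p\<in>cells m n. (r1 (east m p) - r1 (west m p)) / (2 * hx) + (r2 (north n p) - r2 (south n p)) / (2 * hy)) = 0"
    by (simp add: sum.distrib sum_divide_distrib[symmetric] sum_subtractf sum_east_west sum_north_south)
  finally show ?thesis by simp
qed

lemma laplace_h_periodic_ext:
  assumes "weighted_graph (cells m n) (torus_weight m n hx hy)" "p \<in> cells m n"
  shows "laplace_h hx hy (periodic_ext m n f) p =
    weighted_graph.lap (cells m n) (torus_weight m n hx hy) f p"
proof -
  obtain i j where p: "p = (i, j)" by (cases p)
  then have c: "(i, j) \<in> cells m n" "i \<ge> 1" "j \<ge> 1" using assms by (auto simp: cells_def)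
  have "weighted_graph.lap (cells m n) (torus_weight m n hx hy) f p =
    (f (east m p) - f p + (f (west m p) - f p)) / hx\<^sup>2 + (f (north n p) - f p + (f (south n p) - f p)) / hy\<^sup>2"
    unfolding weighted_graph.lap_def[OF assms(1)] by (rule sum_torus_weight[OF assms(2)])
  moreover have "laplace_h hx hy (periodic_ext m n f) p =
    ((f (east m p) - f p) / hx - (f p - f (west m p)) / hx) / hx + ((f (north n p) - f p) / hy - (f p - f (south n p)) / hy) / hy"
    unfolding p laplace_h_def d_x_def d_y_def D_x_def D_y_def
    using c periodic_ext_neighbour[OF c(1)] periodic_ext_cells[OF c(1)] by simp
  ultimately show ?thesis
    by (simp add: power2_eq_square diff_divide_distrib add_divide_distrib)
qed

lemma mu_eq:
  assumes "gradient_flow (cells m n) (torus_weight m n hx hy) u S (dS M N) kappa dkappa"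
    and \<phi>: "\<phi> \<in> grid_fun m n" "periodic_grid m n \<phi>" and mn: "m > 0" "n > 0" and "p \<in> cells m n"
  shows "mu M N \<chi> hx hy \<phi>k \<phi> p = gradient_flow.\<mu> (cells m n) (torus_weight m n hx hy) (dS M N) kappa dkappa
    (\<lambda>p. dH M N \<chi> (\<phi>k p)) \<phi> p"
proof -
  interpret gradient_flow "cells m n" "torus_weight m n hx hy" u S "dS M N" kappa dkappa "\<lambda>p. dH M N \<chi> (\<phi>k p)"
    by (rule assms(1))
  obtain i j where p: "p = (i, j)" by (cases p)
  then have c: "(i, j) \<in> cells m n" "i \<ge> 1" "j \<ge> 1" using assms by (auto simp: cells_def)
  have nb: "\<phi> (Suc i, j) = \<phi> (east m p)" "\<phi> (i - 1, j) = \<phi> (west m p)"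
    "\<phi> (i, Suc j) = \<phi> (north n p)" "\<phi> (i, j - 1) = \<phi> (south n p)"
    using periodic_ext_neighbour[OF c(1), of \<phi>] periodic_ext_eq[OF \<phi> mn] by (simp_all add: p)
  \<comment> \<open>The identity in one grid direction, with \<open>x\<close> the value at the
    centre, \<open>e\<close> and \<open>w\<close> those at the two neighbours.\<close>
  have axis: "dkappa x * ((((e - x) / h)\<^sup>2 + ((x - w) / h)\<^sup>2) / 2)
      - 2 * (((kappa e + kappa x) / 2 * ((e - x) / h) - (kappa x + kappa w) / 2 * ((x - w) / h)) / h)
    = (d_pair_energy x e + d_pair_energy x w) / h\<^sup>2" for x e w h :: real
  proof -
    have "((e - x) / h)\<^sup>2 = (e - x)\<^sup>2 / h\<^sup>2" "((x - w) / h)\<^sup>2 = (w - x)\<^sup>2 / h\<^sup>2"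
      by (simp_all add: power_divide power2_commute)
    moreover have "2 * (((kappa e + kappa x) / 2 * ((e - x) / h) - (kappa x + kappa w) / 2 * ((x - w) / h)) / h)
      = ((kappa x + kappa e) * (e - x) + (kappa x + kappa w) * (w - x)) / h\<^sup>2"
      by (simp add: power2_eq_square diff_divide_distrib add_divide_distrib algebra_simps)
    ultimately show ?thesis
      by (simp add: d_pair_energy_def add_divide_distrib diff_divide_distrib distrib_left)
  qed
  have "mu M N \<chi> hx hy \<phi>k \<phi> p = dS M N (\<phi> p) + dH M N \<chi> (\<phi>k p)
    + (dkappa (\<phi> p) * ((((\<phi> (east m p) - \<phi> p) / hx)\<^sup>2 + ((\<phi> p - \<phi> (west m p)) / hx)\<^sup>2) / 2)
      - 2 * (((kappa (\<phi> (east m p)) + kappa (\<phi> p)) / 2 * ((\<phi> (east m p) - \<phi> p) / hx)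
              - (kappa (\<phi> p) + kappa (\<phi> (west m p))) / 2 * ((\<phi> p - \<phi> (west m p)) / hx)) / hx))
    + (dkappa (\<phi> p) * ((((\<phi> (north n p) - \<phi> p) / hy)\<^sup>2 + ((\<phi> p - \<phi> (south n p)) / hy)\<^sup>2) / 2)
      - 2 * (((kappa (\<phi> (north n p)) + kappa (\<phi> p)) / 2 * ((\<phi> (north n p) - \<phi> p) / hy)
              - (kappa (\<phi> p) + kappa (\<phi> (south n p))) / 2 * ((\<phi> p - \<phi> (south n p)) / hy)) / hy))"
    unfolding mu_def p a_x_def a_y_def d_x_def d_y_def A_x_def A_y_def D_x_def D_y_def prod.case
    using c(2,3) nb by (simp add: p distrib_left)
  also have "\<dots> = \<mu> \<phi> p"
    unfolding axis \<mu>_def sum_torus_weight[OF \<open>p \<in> cells m n\<close>] by simp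
  finally show ?thesis .
qed

section \<open>The scheme as an implicit gradient flow\<close>

theorem corollary3p11:
  fixes M N \<chi> Lx Ly \<epsilon> s hx hy :: real and m n :: nat
    and \<phi>k r1 r2 :: "nat \<times> nat \<Rightarrow> real"
  assumes "M > 0" and "N > 0" and "\<chi> > 0" and "Lx > 0" and "Ly > 0"
    and "m > 0" and "n > 0" and "\<epsilon> > 0" and "s > 0"
    and "hx = Lx / real m" and "hy = Ly / real n"
    and "admissible M N m n \<phi>k"
  shows "\<exists>!\<phi>. admissible M N m n \<phi> \<and>
           (\<forall>p\<in>cells m n.
              \<phi> p - \<phi>k p = s * laplace_h hx hy (periodic_ext m n (mu M N \<chi> hx hy \<phi>k \<phi>)) p
                            + s * \<epsilon> * noise hx hy s m n r1 r2 p)"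
proof -
  have h: "hx > 0" "hy > 0" using assms by auto
  define u where "u = 1 / rho M N"
  have u: "0 < u" "u < 1" using rho_gt_1[OF assms(1,2)] by (auto simp: u_def)
  obtain d where "\<forall>x\<in>{0<..<u}. (S_fun M N has_real_derivative dS M N x + d) (at x)"
    using S_deriv[OF assms(1,2)] unfolding u_def by blast
  then have d: "(S_fun M N has_real_derivative dS M N x + d) (at x)" if "0 < x" "x < u" for x
    using that by simp
  \<comment> \<open>Subtracting \<open>d * x\<close> absorbs the additive constant in the derivative
    of \<open>S_fun\<close>, so that \<open>S\<close> has derivative exactly
    \<open>dS\<close>.\<close>
  define S where "S x = S_fun M N x - d * x" for x
  define H where "H p = dH M N \<chi> (\<phi>k p)" for p
  let ?c = "torus_weight m n hx hy"
  have graph: "weighted_graph (cells m n) ?c"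
    using assms(6,7) h by (rule weighted_graph_torus)
  have flow: "gradient_flow (cells m n) ?c u S (dS M N) kappa dkappa"
  proof (intro gradient_flow.intro graph gradient_flow_axioms.intro)
    show "(S has_real_derivative dS M N x) (at x)" if "0 < x" "x < u" for x
      unfolding S_def using DERIV_diff[OF d[OF that] DERIV_cmult_Id[of d]] by simp
    show "kappa x \<ge> 0" if "0 < x" "x < u" for x
      using that u by (simp add: kappa_def)
    show "(kappa has_real_derivative dkappa x) (at x)" if "0 < x" "x < u" for x
      using that u by (intro kappa_deriv) auto
    show "kappa a' * z'\<^sup>2 \<ge> kappa a * z\<^sup>2 + dkappa a * z\<^sup>2 * (a' - a) + 2 * kappa a * z * (z' - z)"
      if "0 < a" "a < u" "0 < a'" "a' < u" for a a' z z'
      using that u by (intro kappa_perspective) auto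
  qed (use u assms(1,2) in \<open>auto simp: u_def intro: dS_less dS_at_right_0 dS_at_left_max\<close>)
  interpret gradient_flow "cells m n" ?c u S "dS M N" kappa dkappa H by (rule flow)
  define w where "w p = \<phi>k p + s * \<epsilon> * noise hx hy s m n r1 r2 p" for p
  have scheme: "(\<phi> p - \<phi>k p = s * laplace_h hx hy (periodic_ext m n (mu M N \<chi> hx hy \<phi>k \<phi>)) p
      + s * \<epsilon> * noise hx hy s m n r1 r2 p) \<longleftrightarrow> \<phi> p = w p + s * lap (\<mu> \<phi>) p"
    if "\<phi> \<in> grid_fun m n" "periodic_grid m n \<phi>" "p \<in> cells m n" for \<phi> p
  proof -
    have "laplace_h hx hy (periodic_ext m n (mu M N \<chi> hx hy \<phi>k \<phi>)) p = lap (mu M N \<chi> hx hy \<phi>k \<phi>) p"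
      by (rule laplace_h_periodic_ext[OF graph that(3)])
    also have "\<dots> = lap (\<mu> \<phi>) p"
      using mu_eq[OF flow that(1,2) assms(6,7)] that(3)
      by (intro lap_cong) (auto simp: H_def[abs_def])
    finally show ?thesis by (auto simp: w_def)
  qed
  \<comment> \<open>The noise may push \<open>w\<close> out of the interval at single cells, but its
    mean is that of \<open>\<phi>k\<close>, and the mean is all that \<open>ex_solution\<close>
    restricts.\<close>
  have sum_w: "(\<Sum>p\<in>cells m n. w p) = (\<Sum>p\<in>cells m n. \<phi>k p)"
    by (simp add: w_def sum.distrib sum_distrib_left[symmetric] sum_noise)
  have \<phi>k: "0 < \<phi>k p" "\<phi>k p < u" if "p \<in> cells m n" for p
    using assms(12) that by (force simp: admissible_def u_def cells_def grid_def)+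
  have "0 < (\<Sum>p\<in>cells m n. w p)"
    unfolding sum_w using \<phi>k(1) by (intro sum_pos finite_V V_nonempty)
  moreover have "(\<Sum>p\<in>cells m n. w p) < real (card (cells m n)) * u"
    unfolding sum_w using sum_strict_mono[OF finite_V V_nonempty \<phi>k(2)] by simp
  ultimately obtain \<phi> where \<phi>: "\<forall>p\<in>cells m n. 0 < \<phi> p \<and> \<phi> p < u"
      "\<forall>p\<in>cells m n. \<phi> p = w p + s * lap (\<mu> \<phi>) p"
    using ex_solution[OF assms(9)] by blast
  show ?thesis
  proof (rule ex1I)
    let ?\<Phi> = "periodic_ext m n \<phi>"
    note per = periodic_ext_grid_fun[of m n \<phi>] periodic_ext_periodic[OF assms(6,7), of \<phi>]
    \<comment> \<open>\<open>ex_solution\<close> controls \<phi> on cells only; the periodic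
      extension takes all its grid values from there.\<close>
    have "0 < ?\<Phi> p \<and> ?\<Phi> p < 1 / rho M N" if "p \<in> grid m n" for p
    proof -
      obtain i j where p: "p = (i, j)" by (cases p)
      have "(wrap m i, wrap n j) \<in> cells m n"
        using that assms(6,7) by (auto simp: p grid_def cells_def wrap_def)
      then show ?thesis using \<phi>(1) that by (simp add: p periodic_ext_def u_def)
    qed
    moreover have "?\<Phi> p = w p + s * lap (\<mu> ?\<Phi>) p" if "p \<in> cells m n" for p
    proof -
      have "lap (\<mu> ?\<Phi>) p = lap (\<mu> \<phi>) p"
        using that by (intro lap_cong \<mu>_cong periodic_ext_cells)
      then show ?thesis using \<phi>(2) that by (simp add: periodic_ext_cells)
    qed
    ultimately show "admissible M N m n ?\<Phi> \<and> (\<forall>p\<in>cells m n.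
        ?\<Phi> p - \<phi>k p = s * laplace_h hx hy (periodic_ext m n (mu M N \<chi> hx hy \<phi>k ?\<Phi>)) p
                            + s * \<epsilon> * noise hx hy s m n r1 r2 p)"
      using per scheme[OF per] by (auto simp: admissible_def)
  next
    fix \<psi> assume \<psi>: "admissible M N m n \<psi> \<and> (\<forall>p\<in>cells m n.
        \<psi> p - \<phi>k p = s * laplace_h hx hy (periodic_ext m n (mu M N \<chi> hx hy \<phi>k \<psi>)) p
                            + s * \<epsilon> * noise hx hy s m n r1 r2 p)"
    then have per: "\<psi> \<in> grid_fun m n" "periodic_grid m n \<psi>" by (auto simp: admissible_def)
    have "\<psi> p = \<phi> p" if "p \<in> cells m n" for p
    proof (rule unique_solution[OF assms(9) _ _ _ _ that])
      show "0 < \<psi> q \<and> \<psi> q < u" if "q \<in> cells m n" for q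
        using \<psi> that by (force simp: admissible_def u_def cells_def grid_def)
      show "\<psi> q = w q + s * lap (\<mu> \<psi>) q" if "q \<in> cells m n" for q
        using \<psi> scheme[OF per that] that by blast
    qed (use \<phi> in auto)
    \<comment> \<open>Agreement on cells gives equal periodic extensions, and an admissible function
      is its own periodic extension.\<close>
    then have "periodic_ext m n \<psi> = periodic_ext m n \<phi>"
      using assms(6,7) by (intro periodic_ext_cong)
    then show "\<psi> = periodic_ext m n \<phi>"
      using periodic_ext_eq[OF per assms(6,7)] by simp
  qed
qed

end
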